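(* Let $G$ be a connected graph with $n\geq 4$ vertices and $m$ edges having $p\geq 1$ vertices of degree $r$ and $q\geq 1$ ($q\neq p$) vertices of degree $s$, where $s> r\geq 1$. Say Brouwer's conjecture holds for $k$ if $S_k(G)\le m+\frac{k(k+1)}{2}$. (i) If $m\geq \frac{(2n-r-1)r}{2}$, then Brouwer's conjecture holds for all integers $k \in [1,r]$. (ii) If either $n>p+s+\frac{1}{2}$ and $m\geq \frac{s(2n-2p-s-1)}{2}+pr$, or $n<p+r+\frac{3}{2}$ and $m\geq \frac{(r+1)(2n-2p-r-2)}{2}+pr$, then Brouwer's conjecture holds for all integers $k \in [r+1,s]$. (iii) If $p+q<\frac{n}{2}$ and $m \geq \frac{(n-1)(3n-1)}{8}-\frac{(n-2r-1)}{2}p-\frac{(n-2s-1)}{2}q$, then Brouwer's conjecture holds for all integers $k$ with $s+1\leq k\leq\frac{n-1}{2}$. (iv) If $p+q>\frac{n}{2}$ and $m \geq \frac{(n-1)(3n-1)}{8}-\frac{(n-2r-1)}{2}p-\frac{(n-2s-1)}{2}q$, then Brouwer's conjecture holds for all integers $k$ with $\frac{n-1}{2}\leq k\leq n$.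
   Context: The Laplacian matrix of a graph is $L(G)=D(G)-A(G)$ with eigenvalues $\mu_1\ge\dots\ge\mu_n=0$; $S_k(G)=\sum_{i=1}^k\mu_i$. *)

theory Defs
  imports
    "HOL-Computational_Algebra.Polynomial"
    "Jordan_Normal_Form.Char_Poly"
    "Graph_Theory.Graph_Theory"
begin

text \<open>
  A simple graph is a symmetric digraph in the sense of the locale \<^locale>\<open>graph\<close>: every undirected
  edge $uv$ is represented by the two arcs $(u,v)$ and $(v,u)$. The degree of a vertex is
  therefore its out-degree, and undirected edges have to be counted as two-element sets.
\<close>

definition edge_set :: "('a, 'b) pre_digraph \<Rightarrow> 'a set set" where
  "edge_set G = {{u, v} | u v. (u, v) \<in> arcs_ends G}"

text \<open>
  Matrices are indexed by natural numbers, so an enumeration of the vertices is fixed. Another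
  choice permutes rows and columns simultaneously and does not affect the spectrum.
\<close>

definition vertex_list :: "('a, 'b) pre_digraph \<Rightarrow> 'a list" where
  "vertex_list G = (SOME vs. distinct vs \<and> set vs = verts G)"

definition degree_matrix :: "('a, 'b) pre_digraph \<Rightarrow> real mat" where
  "degree_matrix G = (let n = card (verts G); vs = vertex_list G in
     mat n n (\<lambda>(i, j). if i = j then real (out_degree G (vs ! i)) else 0))"

definition adjacency_matrix :: "('a, 'b) pre_digraph \<Rightarrow> real mat" where
  "adjacency_matrix G = (let n = card (verts G); vs = vertex_list G in
     mat n n (\<lambda>(i, j). if (vs ! i, vs ! j) \<in> arcs_ends G then 1 else 0))"

definition laplacian_matrix :: "('a, 'b) pre_digraph \<Rightarrow> real mat" where
  "laplacian_matrix G = degree_matrix G - adjacency_matrix G"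

text \<open>
  The eigenvalues with multiplicity in non-increasing order. As the Laplacian matrix is real
  symmetric, its characteristic polynomial splits over the reals, so no eigenvalue is lost by
  taking real roots only.
\<close>

definition laplacian_eigenvalues :: "('a, 'b) pre_digraph \<Rightarrow> real list" where
  "laplacian_eigenvalues G =
     rev (sorted_list_of_multiset (proots (char_poly (laplacian_matrix G))))"

text \<open>The list is indexed from \<open>0\<close>, so the largest eigenvalue $\mu_1$ is the entry at \<open>0\<close>.\<close>

definition laplacian_sum :: "('a, 'b) pre_digraph \<Rightarrow> nat \<Rightarrow> real" where
  "laplacian_sum G k = (\<Sum>i<k. laplacian_eigenvalues G ! i)"

definition brouwer_holds :: "('a, 'b) pre_digraph \<Rightarrow> nat \<Rightarrow> bool" where
  "brouwer_holds G k \<longleftrightarrow>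
     laplacian_sum G k \<le> real (card (edge_set G)) + real k * (real k + 1) / 2"

end

theory Submission
  imports Defs "HOL-Analysis.Function_Topology"
begin

text \<open>
  The theorem follows from a Grone--Merris type inequality: for every set $W$ of vertices,
  $S_k \le k (n - |W|) + \sum_{v \in W} d_v$. Taking for $W$ the empty set, the vertices of degree
  $r$, or those of degree $r$ or $s$, the hypotheses on $m$ say exactly that this bound is at most
  $m + k(k+1)/2$ at the worst $k$ of the given range.

  For the inequality, deleting the edges inside $W$ and completing the complement of $W$ to a
  clique $K$ changes both sides in the right direction (Bessel and monotonicity), so the graph may
  be assumed to be split. For $k \ge |K|$ it suffices to treat $k = N = |K|$, because
  $\mu_{N+1} \le N$; the case $k < N$ is the case $n - 1 - k$ of the complement.

  The case $k = N$ uses an idea of Bai. The $N$-dimensional spaces spanned by the columns of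
  $V = (I, -Y)^T$ with $Y \ge 0$ column stochastic are mapped to spaces of the same kind by
  $I + \varepsilon L$, say $(I + \varepsilon L) V = V' X$, and
  $\det X \le 1 + \varepsilon (N^2 + \sum_{v \notin K} d_v) + O(\varepsilon^2)$.
  With $\Phi$ the matrix of the top $N$ eigenvectors,
  $\prod_i (1 + \varepsilon \mu_i) \det(\Phi^T V) = \det(\Phi^T V') \det X$. As
  $\det(\Phi^T V)$ stays bounded over all such $V$ and is not identically zero, comparing suprema
  gives $\prod_i (1 + \varepsilon \mu_i) \le \sup \det X$, and $\varepsilon \to 0$ yields
  $\sum_i \mu_i \le N^2 + \sum_{v \notin K} d_v$.
\<close>

section \<open>Determinants\<close>

text \<open>Square matrices are given by entry functions on \<open>nat\<close>, so that products
  become sums over \<open>{..<N}\<close> and the library determinant still applies.\<close>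

abbreviation fmat :: "nat \<Rightarrow> (nat \<Rightarrow> nat \<Rightarrow> real) \<Rightarrow> real mat" where
  "fmat N A \<equiv> mat N N (\<lambda>(i, j). A i j)"

lemma fmat_mult:
  "fmat N A * fmat N B = fmat N (\<lambda>i j. \<Sum>k<N. A i k * B k j)"
  by (rule eq_matI) (auto simp: scalar_prod_def lessThan_atLeast0)

lemma det_fmat_mult:
  "det (fmat N (\<lambda>i j. \<Sum>k<N. A i k * B k j)) = det (fmat N A) * det (fmat N B)"
  unfolding fmat_mult[symmetric] by (rule det_mult[of _ N]) auto

lemma det_fmat_row_scale:
  "det (fmat N (\<lambda>i j. c i * A i j)) = (\<Prod>i<N. c i) * det (fmat N A)"
proof -
  have "fmat N (\<lambda>i j. c i * A i j) = fmat N (\<lambda>i j. \<Sum>k<N. (if i = k then c i else 0) * A k j)"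
    by (rule cong_mat) (auto simp: if_distrib if_distribR cong: if_cong)
  moreover have "det (fmat N (\<lambda>i k. if i = k then c i else 0)) = (\<Prod>i<N. c i)"
    by (subst det_upper_triangular[of _ N])
      (auto simp: upper_triangular_def diag_mat_def prod.distinct_set_conv_list[symmetric]
        lessThan_atLeast0 simp flip: prod.list_conv_set_nth cong: map_cong)
  ultimately show ?thesis by (simp add: det_fmat_mult)
qed

lemma permutes_lessThan: "p permutes {0..<N} \<Longrightarrow> i < N \<Longrightarrow> p i < (N::nat)"
  using permutes_in_image[of p "{0..<N}" i] by simp

text \<open>Leibniz formula: each of the \<open>fact N\<close> terms is at most \<open>c ^ N\<close>
  in absolute value.\<close>

lemma abs_det_fmat_le:
  assumes "\<And>i j. i < N \<Longrightarrow> j < N \<Longrightarrow> \<bar>A i j\<bar> \<le> c"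
  shows "\<bar>det (fmat N A)\<bar> \<le> fact N * c ^ N"
proof -
  have "\<bar>det (fmat N A)\<bar> = \<bar>\<Sum>p | p permutes {0..<N}. signof p * (\<Prod>i = 0..<N. A i (p i))\<bar>"
    by (subst det_def'[of _ N]) (auto intro!: arg_cong[where f = abs] sum.cong prod.cong
        simp: permutes_lessThan)
  also have "\<dots> \<le> (\<Sum>p | p permutes {0..<N}. \<bar>signof p * (\<Prod>i = 0..<N. A i (p i))\<bar>)"
    by (rule sum_abs)
  also have "\<dots> \<le> (\<Sum>p | p permutes {0..<N}. c ^ N)"
  proof (rule sum_mono)
    fix p assume "p \<in> {p. p permutes {0..<N}}"
    then have "\<bar>\<Prod>i = 0..<N. A i (p i)\<bar> \<le> (\<Prod>i = 0..<N. c)"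
      unfolding abs_prod by (intro prod_mono) (auto intro!: assms simp: permutes_lessThan)
    then show "\<bar>signof p * (\<Prod>i = 0..<N. A i (p i))\<bar> \<le> c ^ N"
      by (simp add: abs_mult sign_def)
  qed
  also have "\<dots> = fact N * c ^ N"
    by (simp add: card_permutations[of "{0..<N}" N])
  finally show ?thesis .
qed

text \<open>A permutation other than the identity moves at least two points, so its Leibniz term
  contains two off-diagonal factors. The square of \<delta> is essential: with \<delta> = \<epsilon>
  the error is of second order and disappears in the limit.\<close>

lemma det_fmat_near_diagonal:
  assumes diag: "\<And>i. i < N \<Longrightarrow> \<bar>A i i\<bar> \<le> c"
    and off: "\<And>i j. i < N \<Longrightarrow> j < N \<Longrightarrow> i \<noteq> j \<Longrightarrow> \<bar>A i j\<bar> \<le> \<delta>"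
    and c: "1 \<le> c" and d: "0 \<le> \<delta>" "\<delta> \<le> 1"
  shows "\<bar>det (fmat N A) - (\<Prod>i<N. A i i)\<bar> \<le> fact N * (\<delta>\<^sup>2 * c ^ N)"
proof -
  let ?P = "{p. p permutes {0..<N}}"
  let ?t = "\<lambda>p. signof p * (\<Prod>i = 0..<N. A i (p i))"
  have fin: "finite ?P" by (simp add: finite_permutations)
  have idP: "id \<in> ?P" by (simp add: permutes_id)
  have "det (fmat N A) = (\<Sum>p \<in> ?P. ?t p)"
    by (subst det_def'[of _ N]) (auto intro!: sum.cong prod.cong simp: permutes_lessThan)
  also have "\<dots> = ?t id + (\<Sum>p \<in> ?P - {id}. ?t p)"
    by (rule sum.remove[OF fin idP])
  also have "?t id = (\<Prod>i<N. A i i)" by (simp add: lessThan_atLeast0)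
  finally have "\<bar>det (fmat N A) - (\<Prod>i<N. A i i)\<bar> = \<bar>\<Sum>p \<in> ?P - {id}. ?t p\<bar>"
    by (simp only: add_diff_cancel_left')
  also have "\<dots> \<le> (\<Sum>p \<in> ?P - {id}. \<bar>?t p\<bar>)" by (rule sum_abs)
  also have "\<dots> \<le> (\<Sum>p \<in> ?P - {id}. \<delta>\<^sup>2 * c ^ N)"
  proof (rule sum_mono)
    fix p assume p: "p \<in> ?P - {id}"
    then have pp: "p permutes {0..<N}" by auto
    obtain i where i: "p i \<noteq> i" using p by (auto simp: fun_eq_iff)
    then have iN: "i < N" using permutes_not_in[OF pp, of i] by (cases "i < N") auto
    then have piN: "p i < N" using pp by (simp add: permutes_lessThan)
    \<comment> \<open>By injectivity \<open>p i\<close> is moved as well; this supplies the second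
      off-diagonal factor.\<close>
    have ppi: "p (p i) \<noteq> p i" using i permutes_inj[OF pp] by (auto dest: injD)
    let ?I = "{0..<N}"
    have "\<bar>?t p\<bar> = (\<Prod>j\<in>?I. \<bar>A j (p j)\<bar>)"
      by (simp add: abs_mult sign_def abs_prod)
    also have "\<dots> = \<bar>A i (p i)\<bar> * (\<Prod>j\<in>?I - {i}. \<bar>A j (p j)\<bar>)"
      using iN by (intro prod.remove) auto
    also have "(\<Prod>j\<in>?I - {i}. \<bar>A j (p j)\<bar>)
        = \<bar>A (p i) (p (p i))\<bar> * (\<Prod>j\<in>?I - {i} - {p i}. \<bar>A j (p j)\<bar>)"
      using piN i by (intro prod.remove) auto
    also have "\<bar>A i (p i)\<bar> * (\<bar>A (p i) (p (p i))\<bar> * (\<Prod>j\<in>?I - {i} - {p i}. \<bar>A j (p j)\<bar>))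
        \<le> \<delta> * (\<delta> * (\<Prod>j\<in>?I - {i} - {p i}. c))"
    proof (intro mult_mono prod_mono conjI prod_nonneg mult_nonneg_nonneg)
      show "\<bar>A i (p i)\<bar> \<le> \<delta>" using off[OF iN piN] i by auto
      show "\<bar>A (p i) (p (p i))\<bar> \<le> \<delta>" using off[OF piN, of "p (p i)"] ppi piN pp
        by (simp add: permutes_lessThan)
      fix j assume j: "j \<in> ?I - {i} - {p i}"
      then have "p j < N" using pp by (simp add: permutes_lessThan)
      then show "\<bar>A j (p j)\<bar> \<le> c"
        using j diag[of j] off[of j "p j"] c d by (cases "p j = j") auto
    qed (use d c in auto)
    also have "\<dots> \<le> \<delta> * (\<delta> * c ^ N)"
    proof -
      have "card (?I - {i} - {p i}) \<le> card ?I" by (intro card_mono) auto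
      then have "(\<Prod>j\<in>?I - {i} - {p i}. c) \<le> c ^ N"
        using c by (simp add: power_increasing)
      then show ?thesis using d by (intro mult_left_mono)
    qed
    finally have "\<bar>?t p\<bar> \<le> \<delta> * (\<delta> * c ^ N)" .
    then show "\<bar>?t p\<bar> \<le> \<delta>\<^sup>2 * c ^ N" by (simp add: power2_eq_square mult.assoc)
  qed
  also have "\<dots> \<le> fact N * (\<delta>\<^sup>2 * c ^ N)"
  proof -
    have "card (?P - {id}) \<le> card ?P" using fin by (intro card_mono) auto
    also have "card ?P = fact N" by (simp add: card_permutations[of "{0..<N}" N])
    finally have "real (card (?P - {id})) \<le> real (fact N)" by (rule of_nat_mono)
    then have "real (card (?P - {id})) \<le> fact N" by simp
    then show ?thesis using c d by (simp add: mult_right_mono)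
  qed
  finally show ?thesis .
qed

text \<open>Stated for the left kernel, because the stochastic matrices below multiply from the left
  and are treated row by row.\<close>

lemma det_fmat_nonzero_iff:
  "det (fmat N A) \<noteq> 0 \<longleftrightarrow> (\<forall>y. (\<forall>i<N. (\<Sum>k<N. y k * A k i) = 0) \<longrightarrow> (\<forall>k<N. y k = 0))"
proof -
  let ?T = "fmat N (\<lambda>i k. A k i)"
  have T: "?T \<in> carrier_mat N N" by simp
  have "det (fmat N A) = det ?T"
    by (subst det_transpose[symmetric, of _ N]) (auto intro!: arg_cong[where f = det])
  moreover have "det ?T = 0 \<longleftrightarrow> (\<exists>v. v \<in> carrier_vec N \<and> v \<noteq> 0\<^sub>v N \<and> ?T *\<^sub>v v = 0\<^sub>v N)"
    by (rule det_0_iff_vec_prod_zero[OF T])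
  moreover have "\<dots> \<longleftrightarrow> (\<exists>y. (\<forall>i<N. (\<Sum>k<N. y k * A k i) = 0) \<and> \<not> (\<forall>k<N. y k = 0))"
  proof
    assume "\<exists>v. v \<in> carrier_vec N \<and> v \<noteq> 0\<^sub>v N \<and> ?T *\<^sub>v v = 0\<^sub>v N"
    then obtain v where v: "v \<in> carrier_vec N" "v \<noteq> 0\<^sub>v N" "?T *\<^sub>v v = 0\<^sub>v N" by blast
    show "\<exists>y. (\<forall>i<N. (\<Sum>k<N. y k * A k i) = 0) \<and> \<not> (\<forall>k<N. y k = 0)"
    proof (intro exI[of _ "\<lambda>k. v $ k"] conjI allI impI)
      fix i assume i: "i < N"
      have "(?T *\<^sub>v v) $ i = 0" using v i by simp
      then show "(\<Sum>k<N. v $ k * A k i) = 0"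
        using i v(1) by (simp add: scalar_prod_def lessThan_atLeast0 mult.commute)
    next
      show "\<not> (\<forall>k<N. v $ k = 0)" using v by (auto intro!: eq_vecI)
    qed
  next
    assume "\<exists>y. (\<forall>i<N. (\<Sum>k<N. y k * A k i) = 0) \<and> \<not> (\<forall>k<N. y k = 0)"
    then obtain y k where y: "\<forall>i<N. (\<Sum>k<N. y k * A k i) = 0" and k: "k < N" "y k \<noteq> 0" by blast
    show "\<exists>v. v \<in> carrier_vec N \<and> v \<noteq> 0\<^sub>v N \<and> ?T *\<^sub>v v = 0\<^sub>v N"
    proof (intro exI[of _ "vec N y"] conjI)
      show "vec N y \<noteq> 0\<^sub>v N" using k by (metis index_vec index_zero_vec(1))
      show "?T *\<^sub>v vec N y = 0\<^sub>v N"
        using y by (auto intro!: eq_vecI simp: scalar_prod_def lessThan_atLeast0 mult.commute)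
    qed auto
  qed
  ultimately have "det (fmat N A) = 0 \<longleftrightarrow>
      (\<exists>y. (\<forall>i<N. (\<Sum>k<N. y k * A k i) = 0) \<and> \<not> (\<forall>k<N. y k = 0))" by (simp only:)
  then show ?thesis by (simp only: not_ex de_Morgan_conj not_not imp_conv_disj)
qed

lemma row_system_solvable:
  assumes "det (fmat N A) \<noteq> 0"
  shows "\<exists>y. \<forall>i<N. (\<Sum>k<N. y k * A k i) = w i"
proof -
  obtain B where Bc: "B \<in> carrier_mat N N" and B: "B * fmat N A = 1\<^sub>m N"
    using det_non_zero_imp_unit[of "fmat N A" N "undefined::unit"] assms
    unfolding Units_def ring_mat_def by auto
  have BA: "(\<Sum>k<N. B $$ (j,k) * A k i) = (if j = i then 1 else 0)" if "i < N" "j < N" for i j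
  proof -
    have "(B * fmat N A) $$ (j,i) = (1\<^sub>m N) $$ (j,i)"
      using B by simp
    then show ?thesis using that Bc by (simp add: scalar_prod_def lessThan_atLeast0)
  qed
  have "(\<Sum>k<N. (\<Sum>j<N. w j * B $$ (j,k)) * A k i) = w i" if "i < N" for i
  proof -
    have "(\<Sum>k<N. (\<Sum>j<N. w j * B $$ (j,k)) * A k i) = (\<Sum>j<N. w j * (\<Sum>k<N. B $$ (j,k) * A k i))"
      unfolding sum_distrib_left sum_distrib_right by (subst sum.swap) (simp add: mult.assoc)
    also have "\<dots> = w i" using that by (simp add: BA if_distrib cong: if_cong)
    finally show ?thesis .
  qed
  then show ?thesis by (intro exI[of _ "\<lambda>k. \<Sum>j<N. w j * B $$ (j,k)"] allI impI)
qed

section \<open>Stochastic frames for split graphs\<close>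

text \<open>A split graph with clique \<open>{..<N}\<close> and coclique \<open>{..<M}\<close>;
  \<open>a i j\<close> is the weight of the edge from clique vertex \<open>i\<close> to coclique
  vertex \<open>j\<close>.\<close>

locale split_weights =
  fixes N M :: nat and a :: "nat \<Rightarrow> nat \<Rightarrow> real"
  assumes a_nonneg: "i < N \<Longrightarrow> j < M \<Longrightarrow> 0 \<le> a i j"
    and a_le_1: "i < N \<Longrightarrow> j < M \<Longrightarrow> a i j \<le> 1"
    and M_pos: "0 < M"
begin

text \<open>Only the edges into the coclique are counted: the full degree of clique vertex
  \<open>i\<close> is N - 1 + \<open>d i\<close>, while \<open>e j\<close> is the full degree of
  coclique vertex \<open>j\<close>.\<close>

definition d :: "nat \<Rightarrow> real" where "d i = (\<Sum>j<M. a i j)"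

definition e :: "nat \<Rightarrow> real" where "e j = (\<Sum>i<N. a i j)"

definition stochastic :: "(nat \<Rightarrow> nat \<Rightarrow> real) \<Rightarrow> bool" where
  "stochastic Y \<longleftrightarrow> (\<forall>j<M. \<forall>i<N. 0 \<le> Y j i) \<and> (\<forall>i<N. (\<Sum>j<M. Y j i) = 1)"

text \<open>With J the all-one matrix this is J - aY, which is what the upper block of LV subtracts
  from the diagonal matrix with entries N + \<open>d i\<close>.\<close>

definition C :: "(nat \<Rightarrow> nat \<Rightarrow> real) \<Rightarrow> nat \<Rightarrow> nat \<Rightarrow> real" where
  "C Y k i = 1 - (\<Sum>j<M. a k j * Y j i)"

text \<open>If the columns of $V = (I, -Y)^T$ are moved by $I + \varepsilon L$, then
  $(I + \varepsilon L) V$ has the upper block \<open>X \<epsilon> Y\<close>.\<close>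

definition X :: "real \<Rightarrow> (nat \<Rightarrow> nat \<Rightarrow> real) \<Rightarrow> nat \<Rightarrow> nat \<Rightarrow> real" where
  "X \<epsilon> Y k i = (if k = i then 1 + \<epsilon> * (real N + d i) else 0) - \<epsilon> * C Y k i"

lemma d_bounds: "i < N \<Longrightarrow> 0 \<le> d i" "i < N \<Longrightarrow> d i \<le> M"
proof -
  assume i: "i < N"
  show "0 \<le> d i" unfolding d_def using i by (auto intro!: sum_nonneg a_nonneg)
  have "d i \<le> (\<Sum>j<M. 1)" unfolding d_def using i by (intro sum_mono) (auto intro: a_le_1)
  then show "d i \<le> M" by simp
qed

lemma e_nonneg: "j < M \<Longrightarrow> 0 \<le> e j"
  unfolding e_def by (auto intro!: sum_nonneg a_nonneg)

text \<open>The entries of aY are averages of weights from [0, 1] with respect to the columns of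
  \<open>Y\<close>.\<close>

lemma C_bounds:
  assumes Y: "stochastic Y" and k: "k < N" and i: "i < N"
  shows "0 \<le> C Y k i" "C Y k i \<le> 1"
proof -
  have "(\<Sum>j<M. a k j * Y j i) \<le> (\<Sum>j<M. Y j i)"
    using Y k i by (intro sum_mono) (auto simp: stochastic_def intro!: mult_left_le_one_le a_le_1 a_nonneg)
  then show "0 \<le> C Y k i" using Y i by (simp add: C_def stochastic_def)
  have "0 \<le> (\<Sum>j<M. a k j * Y j i)"
    using Y k i by (intro sum_nonneg) (auto simp: stochastic_def intro!: mult_nonneg_nonneg a_nonneg)
  then show "C Y k i \<le> 1" by (simp add: C_def)
qed

lemma X_row:
  assumes "i < N"
  shows "(\<Sum>k<N. y k * X \<epsilon> Y k i) = y i * (1 + \<epsilon> * (real N + d i)) - \<epsilon> * (\<Sum>k<N. y k * C Y k i)"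
proof -
  have "(\<Sum>k<N. y k * X \<epsilon> Y k i)
      = (\<Sum>k<N. (if k = i then y k * (1 + \<epsilon> * (real N + d i)) else 0) - \<epsilon> * (y k * C Y k i))"
    unfolding X_def by (intro sum.cong) (auto simp: algebra_simps)
  then show ?thesis using assms by (simp add: sum_subtractf sum_distrib_left)
qed

text \<open>The all-one vector is in the kernel of L. Hence, for stochastic \<open>Y\<close>, the
  columns of (I + \<epsilon>L)V sum to zero like those of V, and the upper block has the column sums
  of the negated lower block.\<close>

lemma X_column_sum:
  assumes "i < N"
  shows "(\<Sum>k<N. X \<epsilon> Y k i) = 1 + \<epsilon> * (d i + (\<Sum>j<M. e j * Y j i))"
proof -
  have "(\<Sum>k<N. C Y k i) = N - (\<Sum>k<N. \<Sum>j<M. a k j * Y j i)"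
    unfolding C_def by (simp add: sum_subtractf)
  also have "(\<Sum>k<N. \<Sum>j<M. a k j * Y j i) = (\<Sum>j<M. e j * Y j i)"
    unfolding e_def sum_distrib_right by (rule sum.swap)
  finally have C: "(\<Sum>k<N. C Y k i) = N - (\<Sum>j<M. e j * Y j i)" .
  have "(\<Sum>k<N. X \<epsilon> Y k i) = 1 + \<epsilon> * (real N + d i) - \<epsilon> * (\<Sum>k<N. C Y k i)"
    using X_row[OF assms, of "\<lambda>_. 1" \<epsilon> Y] by simp
  then show ?thesis unfolding C by (simp add: algebra_simps)
qed

text \<open>\<open>X \<epsilon> Y\<close> is a nonsingular M-matrix, so its inverse is nonnegative.\<close>

lemma X_inverse_nonneg:
  assumes Y: "stochastic Y" and \<epsilon>: "0 < \<epsilon>"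
    and pos: "\<And>i. i < N \<Longrightarrow> 0 \<le> (\<Sum>k<N. y k * X \<epsilon> Y k i)" and k: "k < N"
  shows "0 \<le> y k"
proof (rule ccontr)
  assume neg: "\<not> 0 \<le> y k"
  have fin: "finite (y ` {..<N})" and ne: "y ` {..<N} \<noteq> {}" using k by auto
  \<comment> \<open>Minimum principle: in the column of a smallest, negative entry, the other terms
    cannot compensate, because the columns of \<open>C Y\<close> sum to at most N.\<close>
  obtain i where i: "i < N" and yi: "y i = Min (y ` {..<N})"
    using Min_in[OF fin ne] by auto
  have min: "y i \<le> y l" if "l < N" for l using that yi by simp
  have yi0: "y i < 0" using min[OF k] neg by simp
  have "(\<Sum>l<N. C Y l i) \<le> (\<Sum>l<N. 1)" using C_bounds[OF Y _ i] by (intro sum_mono) auto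
  then have "y i * N \<le> y i * (\<Sum>l<N. C Y l i)"
    using yi0 by (intro mult_left_mono_neg) auto
  also have "\<dots> \<le> (\<Sum>l<N. y l * C Y l i)"
    unfolding sum_distrib_left using C_bounds[OF Y _ i] min by (intro sum_mono mult_right_mono) auto
  finally have "\<epsilon> * (y i * N) \<le> \<epsilon> * (\<Sum>l<N. y l * C Y l i)" using \<epsilon> by simp
  with pos[OF i] have "0 \<le> y i * (1 + \<epsilon> * (real N + d i)) - \<epsilon> * (y i * N)"
    unfolding X_row[OF i] by linarith
  then have "0 \<le> y i * (1 + \<epsilon> * d i)" by (simp add: algebra_simps)
  moreover have "0 < 1 + \<epsilon> * d i" using \<epsilon> d_bounds(1)[OF i] by (simp add: add_pos_nonneg)
  ultimately show False using yi0 by (simp add: zero_le_mult_iff)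
qed

text \<open>A vector in the left kernel and its negative are both nonnegative by
  \<open>X_inverse_nonneg\<close>.\<close>

lemma det_X_nonzero:
  assumes Y: "stochastic Y" and \<epsilon>: "0 < \<epsilon>"
  shows "det (fmat N (X \<epsilon> Y)) \<noteq> 0"
  unfolding det_fmat_nonzero_iff
proof (intro allI impI)
  fix y k assume y: "\<forall>i<N. (\<Sum>k<N. y k * X \<epsilon> Y k i) = 0" and k: "k < N"
  have "0 \<le> y k" using X_inverse_nonneg[OF Y \<epsilon> _ k, of y] y by simp
  moreover have "0 \<le> - y k"
    using X_inverse_nonneg[OF Y \<epsilon> _ k, of "\<lambda>k. - y k"] y by (simp add: sum_negf)
  ultimately show "y k = 0" by simp
qed

text \<open>Solve YB = W row by row. If B and W have equal column sums, then the column sums of Y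
  minus 1 form a left kernel vector of B, hence vanish. This serves both the step from V to V' and
  the construction of a good starting frame.\<close>

lemma stochastic_quotient:
  assumes det: "det (fmat N B) \<noteq> 0"
    and nonneg: "\<And>y j i. j < M \<Longrightarrow> \<forall>i<N. (\<Sum>k<N. y k * B k i) = W j i \<Longrightarrow> i < N \<Longrightarrow> 0 \<le> y i"
    and cols: "\<And>i. i < N \<Longrightarrow> (\<Sum>k<N. B k i) = (\<Sum>j<M. W j i)"
  obtains Y where "stochastic Y" "\<And>j i. j < M \<Longrightarrow> i < N \<Longrightarrow> (\<Sum>k<N. Y j k * B k i) = W j i"
proof -
  have "\<forall>j. \<exists>y. \<forall>i<N. (\<Sum>k<N. y k * B k i) = W j i"
    using row_system_solvable[OF det] by blast
  then obtain Y where Y: "\<And>j. \<forall>i<N. (\<Sum>k<N. Y j k * B k i) = W j i" by metis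
  have "\<forall>i<N. (\<Sum>k<N. ((\<Sum>j<M. Y j k) - 1) * B k i) = 0"
  proof (intro allI impI)
    fix i assume i: "i < N"
    have "(\<Sum>k<N. (\<Sum>j<M. Y j k) * B k i) = (\<Sum>j<M. \<Sum>k<N. Y j k * B k i)"
      unfolding sum_distrib_right by (rule sum.swap)
    also have "\<dots> = (\<Sum>j<M. W j i)" using Y i by simp
    finally show "(\<Sum>k<N. ((\<Sum>j<M. Y j k) - 1) * B k i) = 0"
      using cols[OF i] by (simp add: left_diff_distrib sum_subtractf)
  qed
  then have "\<forall>k<N. (\<Sum>j<M. Y j k) - 1 = 0" 
    using det[unfolded det_fmat_nonzero_iff, THEN spec, of "\<lambda>k. (\<Sum>j<M. Y j k) - 1"] by (rule mp[rotated])
  then have "stochastic Y" unfolding stochastic_def using nonneg[OF _ Y] by auto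
  then show ?thesis using that Y by blast
qed

text \<open>The right-hand side is the negated lower block of (I + \<epsilon>L)V; dividing it by the
  upper block \<open>X \<epsilon> Y\<close> normalizes the moved frame to the form (I, -Y')
  again.\<close>

lemma stochastic_step:
  assumes Y: "stochastic Y" and \<epsilon>: "0 < \<epsilon>"
  obtains Y' where "stochastic Y'"
    "\<And>j i. j < M \<Longrightarrow> i < N \<Longrightarrow>
      (\<Sum>k<N. Y' j k * X \<epsilon> Y k i) = Y j i + \<epsilon> * (a i j + e j * Y j i)"
proof (rule stochastic_quotient[OF det_X_nonzero[OF Y \<epsilon>],
      where W = "\<lambda>j i. Y j i + \<epsilon> * (a i j + e j * Y j i)"])
  fix y j i assume j: "j < M" and i: "i < N"
    and y: "\<forall>i<N. (\<Sum>k<N. y k * X \<epsilon> Y k i) = Y j i + \<epsilon> * (a i j + e j * Y j i)"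
  have "0 \<le> Y j i + \<epsilon> * (a i j + e j * Y j i)" if "i < N" for i
    using Y \<epsilon> that j e_nonneg[OF j] a_nonneg[OF that j] by (simp add: stochastic_def)
  then show "0 \<le> y i" using y X_inverse_nonneg[OF Y \<epsilon> _ i, of y] by simp
next
  fix i assume i: "i < N"
  have "(\<Sum>j<M. Y j i + \<epsilon> * (a i j + e j * Y j i)) = (\<Sum>j<M. Y j i) + \<epsilon> * (d i + (\<Sum>j<M. e j * Y j i))"
    by (simp add: sum.distrib d_def flip: sum_distrib_left)
  then show "(\<Sum>k<N. X \<epsilon> Y k i) = (\<Sum>j<M. Y j i + \<epsilon> * (a i j + e j * Y j i))"
    using X_column_sum[OF i] Y i by (simp add: stochastic_def)
qed (use that in blast)

text \<open>The diagonal product is at most the exponential of \<epsilon> times the trace of the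
  first-order part, where \<open>C\<close> is dropped as nonnegative; off the diagonal the entries
  are at most \<epsilon>, so the remaining Leibniz terms are of second order.\<close>

lemma abs_det_X_le:
  assumes Y: "stochastic Y" and \<epsilon>: "0 < \<epsilon>" "\<epsilon> \<le> 1"
  shows "\<bar>det (fmat N (X \<epsilon> Y))\<bar>
    \<le> exp (\<epsilon> * ((real N)\<^sup>2 + (\<Sum>i<N. d i))) + fact N * (\<epsilon>\<^sup>2 * (1 + real N + M) ^ N)"
proof -
  have diag: "X \<epsilon> Y i i = 1 + \<epsilon> * (N + d i - C Y i i)" for i
    by (simp add: X_def algebra_simps)
  have pos: "0 \<le> real N + d i - C Y i i" if "i < N" for i
    using C_bounds[OF Y that that] d_bounds[OF that] that by linarith
  have "\<bar>det (fmat N (X \<epsilon> Y)) - (\<Prod>i<N. X \<epsilon> Y i i)\<bar> \<le> fact N * (\<epsilon>\<^sup>2 * (1 + real N + M) ^ N)"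
  proof (rule det_fmat_near_diagonal)
    fix i assume i: "i < N"
    define z where "z = N + d i - C Y i i"
    have z: "0 \<le> z" "z \<le> real N + M"
      using pos[OF i] C_bounds[OF Y i i] d_bounds[OF i] by (auto simp: z_def)
    then have "\<epsilon> * z \<le> 1 * z" "0 \<le> \<epsilon> * z" using \<epsilon> by (auto intro: mult_left_le_one_le)
    then show "\<bar>X \<epsilon> Y i i\<bar> \<le> 1 + real N + M"
      unfolding diag z_def[symmetric] using z by linarith
  next
    fix i j assume "i < N" "j < N" "i \<noteq> j"
    then show "\<bar>X \<epsilon> Y i j\<bar> \<le> \<epsilon>"
      using C_bounds[OF Y, of i j] \<epsilon> by (simp add: X_def abs_mult)
  qed (use \<epsilon> in auto)
  moreover have "0 \<le> (\<Prod>i<N. X \<epsilon> Y i i)"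
    using \<epsilon> pos by (intro prod_nonneg) (auto simp: diag)
  moreover have "(\<Prod>i<N. X \<epsilon> Y i i) \<le> exp (\<epsilon> * ((real N)\<^sup>2 + (\<Sum>i<N. d i)))"
  proof -
    have "(\<Prod>i<N. X \<epsilon> Y i i) \<le> (\<Prod>i<N. exp (\<epsilon> * (N + d i - C Y i i)))"
      using \<epsilon> pos by (intro prod_mono) (auto simp: diag exp_ge_add_one_self)
    also have "\<dots> = exp (\<epsilon> * (\<Sum>i<N. N + d i - C Y i i))"
      by (simp add: exp_sum sum_distrib_left)
    also have "\<dots> \<le> exp (\<epsilon> * ((real N)\<^sup>2 + (\<Sum>i<N. d i)))"
    proof -
      have "(\<Sum>i<N. N + d i - C Y i i) \<le> (\<Sum>i<N. N + d i)"
        using C_bounds[OF Y] by (intro sum_mono) auto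
      also have "\<dots> = (real N)\<^sup>2 + (\<Sum>i<N. d i)" by (simp add: sum.distrib power2_eq_square)
      finally show ?thesis using \<epsilon> by simp
    qed
    finally show ?thesis .
  qed
  ultimately show ?thesis by linarith
qed

end

section \<open>Eigenvectors tested against stochastic frames\<close>

lemma one_plus_sum_le_prod:
  fixes f :: "'b \<Rightarrow> real"
  assumes "\<And>i. i \<in> A \<Longrightarrow> 0 \<le> f i"
  shows "1 + sum f A \<le> (\<Prod>i\<in>A. 1 + f i)"
  using assms
proof (induction A rule: infinite_finite_induct)
  case (insert i A)
  have "1 + sum f (insert i A) \<le> (1 + f i) * (1 + sum f A)"
    using insert by (simp add: algebra_simps sum_nonneg)
  also have "\<dots> \<le> (1 + f i) * (\<Prod>i\<in>A. 1 + f i)"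
    using insert by (intro mult_left_mono) auto
  finally show ?case using insert by simp
qed auto

text \<open>N orthonormal eigenvectors orthogonal to the constants, written in blocks:
  \<open>x l\<close> is the restriction of the vector \<open>l\<close> to the clique and
  \<open>y l\<close> the one to the coclique.\<close>

locale split_eigenvectors = split_weights +
  fixes x y :: "nat \<Rightarrow> nat \<Rightarrow> real" and \<mu> :: "nat \<Rightarrow> real"
  assumes eigen_x: "l < N \<Longrightarrow> i < N \<Longrightarrow>
      \<mu> l * x l i = (N + d i) * x l i - (\<Sum>k<N. x l k) - (\<Sum>j<M. a i j * y l j)"
    and eigen_y: "l < N \<Longrightarrow> j < M \<Longrightarrow> \<mu> l * y l j = e j * y l j - (\<Sum>i<N. a i j * x l i)"
    and sum_zero: "l < N \<Longrightarrow> (\<Sum>i<N. x l i) + (\<Sum>j<M. y l j) = 0"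
    and orthonormal: "l < N \<Longrightarrow> l' < N \<Longrightarrow>
      (\<Sum>i<N. x l i * x l' i) + (\<Sum>j<M. y l j * y l' j) = (if l = l' then 1 else 0)"
    and \<mu>_nonneg: "l < N \<Longrightarrow> 0 \<le> \<mu> l"
begin

text \<open>The matrix of inner products of the eigenvectors with the columns of V = (I,
  -Y).\<close>

definition F :: "(nat \<Rightarrow> nat \<Rightarrow> real) \<Rightarrow> nat \<Rightarrow> nat \<Rightarrow> real" where
  "F Y l i = x l i - (\<Sum>j<M. y l j * Y j i)"

lemma x_le_1: "l < N \<Longrightarrow> i < N \<Longrightarrow> \<bar>x l i\<bar> \<le> 1"
  and y_le_1: "l < N \<Longrightarrow> j < M \<Longrightarrow> \<bar>y l j\<bar> \<le> 1"
proof -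
  have one: "(\<Sum>i<N. (x l i)\<^sup>2) + (\<Sum>j<M. (y l j)\<^sup>2) = 1" if "l < N" for l
    using orthonormal[OF that that] by (simp add: power2_eq_square)
  have x0: "0 \<le> (\<Sum>i<N. (x l i)\<^sup>2)" and y0: "0 \<le> (\<Sum>j<M. (y l j)\<^sup>2)" for l
    by (auto intro: sum_nonneg)
  show "\<bar>x l i\<bar> \<le> 1" if "l < N" "i < N"
  proof -
    have "(x l i)\<^sup>2 \<le> (\<Sum>i<N. (x l i)\<^sup>2)" using that by (intro member_le_sum) auto
    then have "(x l i)\<^sup>2 \<le> 1" using one[OF that(1)] y0[of l] by linarith
    then show ?thesis by (simp add: abs_square_le_1)
  qed
  show "\<bar>y l j\<bar> \<le> 1" if "l < N" "j < M"
  proof -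
    have "(y l j)\<^sup>2 \<le> (\<Sum>j<M. (y l j)\<^sup>2)" using that by (intro member_le_sum) auto
    then have "(y l j)\<^sup>2 \<le> 1" using one[OF that(1)] x0[of l] by linarith
    then show ?thesis by (simp add: abs_square_le_1)
  qed
qed

text \<open>Associativity: (x - yY)B = xB - y(YB). It is applied to the upper block of a moved frame
  and to that of the starting frame.\<close>

lemma F_times:
  assumes Y: "\<And>j i. j < M \<Longrightarrow> i < N \<Longrightarrow> (\<Sum>k<N. Y j k * B k i) = W j i" and i: "i < N"
  shows "(\<Sum>k<N. F Y l k * B k i) = (\<Sum>k<N. x l k * B k i) - (\<Sum>j<M. y l j * W j i)"
proof -
  have "(\<Sum>k<N. (\<Sum>j<M. y l j * Y j k) * B k i) = (\<Sum>j<M. y l j * (\<Sum>k<N. Y j k * B k i))"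
    unfolding sum_distrib_left sum_distrib_right by (subst sum.swap) (simp add: mult.assoc)
  also have "\<dots> = (\<Sum>j<M. y l j * W j i)" using Y i by simp
  finally show ?thesis by (simp add: F_def left_diff_distrib sum_subtractf)
qed

text \<open>Evaluating $\Phi^T (I + \varepsilon L) V$ from both sides, where the rows of $\Phi^T$ are the
  eigenvectors.\<close>

lemma F_step:
  assumes Y': "\<And>j i. j < M \<Longrightarrow> i < N \<Longrightarrow>
      (\<Sum>k<N. Y' j k * X \<epsilon> Y k i) = Y j i + \<epsilon> * (a i j + e j * Y j i)"
    and l: "l < N" and i: "i < N"
  shows "(\<Sum>k<N. F Y' l k * X \<epsilon> Y k i) = (1 + \<epsilon> * \<mu> l) * F Y l i"
proof -
  \<comment> \<open>Once these sums are named, the claim is linear: \<open>1\<close> and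
    \<open>2\<close> evaluate the left side, \<open>3\<close> and \<open>4\<close> are the coclique
    and clique eigenvalue equations.\<close>
  define p q r t u where "p = (\<Sum>k<N. x l k)" and "q = (\<Sum>j<M. a i j * y l j)"
    and "r = (\<Sum>j<M. e j * (y l j * Y j i))" and "t = (\<Sum>k<N. x l k * (\<Sum>j<M. a k j * Y j i))"
    and "u = (\<Sum>j<M. y l j * Y j i)"
  have "(\<Sum>k<N. x l k * C Y k i) = p - t"
    unfolding C_def p_def t_def by (simp add: right_diff_distrib sum_subtractf)
  note C = this
  have 1: "(\<Sum>k<N. x l k * X \<epsilon> Y k i) = x l i + \<epsilon> * ((N + d i) * x l i) - \<epsilon> * (p - t)"
    unfolding X_row[OF i] C by (simp add: algebra_simps)
  have "(\<Sum>j<M. y l j * (Y j i + \<epsilon> * (a i j + e j * Y j i)))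
      = (\<Sum>j<M. y l j * Y j i + \<epsilon> * (a i j * y l j) + \<epsilon> * (e j * (y l j * Y j i)))"
    by (rule sum.cong) (auto simp: algebra_simps)
  also have "\<dots> = u + \<epsilon> * q + \<epsilon> * r"
    unfolding u_def q_def r_def by (simp add: sum.distrib sum_distrib_left)
  finally have 2: "(\<Sum>j<M. y l j * (Y j i + \<epsilon> * (a i j + e j * Y j i))) = u + \<epsilon> * q + \<epsilon> * r" .
  have "\<mu> l * u = (\<Sum>j<M. (\<mu> l * y l j) * Y j i)"
    unfolding u_def sum_distrib_left by (simp add: mult.assoc)
  also have "\<dots> = (\<Sum>j<M. e j * (y l j * Y j i) - (\<Sum>k<N. a k j * x l k) * Y j i)"
    by (intro sum.cong refl) (simp add: eigen_y[OF l] left_diff_distrib mult.assoc)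
  also have "\<dots> = r - (\<Sum>j<M. (\<Sum>k<N. a k j * x l k) * Y j i)"
    unfolding r_def by (simp add: sum_subtractf)
  also have "(\<Sum>j<M. (\<Sum>k<N. a k j * x l k) * Y j i) = t"
    unfolding t_def sum_distrib_left sum_distrib_right
    by (subst sum.swap) (auto intro!: sum.cong simp: algebra_simps)
  finally have 3: "\<mu> l * u = r - t" .
  have 4: "\<mu> l * x l i = (N + d i) * x l i - p - q"
    unfolding p_def q_def by (rule eigen_x[OF l i])
  have "(1 + \<epsilon> * \<mu> l) * F Y l i = x l i - u + \<epsilon> * (\<mu> l * x l i - \<mu> l * u)"
    unfolding F_def u_def[symmetric] by (simp add: algebra_simps)
  also have "\<dots> = x l i + \<epsilon> * ((N + d i) * x l i) - \<epsilon> * (p - t) - (u + \<epsilon> * q + \<epsilon> * r)"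
    unfolding 3 4 by (simp add: algebra_simps)
  finally show ?thesis
    using F_times[where Y = Y' and B = "X \<epsilon> Y" and l = l, OF Y' i] unfolding 1 2 by simp
qed

lemma det_F_step:
  assumes Y: "stochastic Y" and \<epsilon>: "0 < \<epsilon>"
  obtains Y' where "stochastic Y'"
    "(\<Prod>l<N. 1 + \<epsilon> * \<mu> l) * det (fmat N (F Y)) = det (fmat N (F Y')) * det (fmat N (X \<epsilon> Y))"
proof -
  obtain Y' where Y': "stochastic Y'" and step: "\<And>j i. j < M \<Longrightarrow> i < N \<Longrightarrow>
      (\<Sum>k<N. Y' j k * X \<epsilon> Y k i) = Y j i + \<epsilon> * (a i j + e j * Y j i)"
    using stochastic_step[OF Y \<epsilon>] by blast
  have "fmat N (\<lambda>l i. \<Sum>k<N. F Y' l k * X \<epsilon> Y k i) = fmat N (\<lambda>l i. (1 + \<epsilon> * \<mu> l) * F Y l i)"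
    by (rule cong_mat) (auto simp: F_step[OF step])
  then have "det (fmat N (F Y')) * det (fmat N (X \<epsilon> Y)) = (\<Prod>l<N. 1 + \<epsilon> * \<mu> l) * det (fmat N (F Y))"
    using det_fmat_mult[of N "F Y'" "X \<epsilon> Y"] by (simp add: det_fmat_row_scale)
  then show ?thesis using that Y' by simp
qed

text \<open>Uniform in \<open>Y\<close>: each entry is a coordinate of a unit vector minus an
  average of further such coordinates, hence at most 2.\<close>

lemma abs_det_F_le:
  assumes Y: "stochastic Y"
  shows "\<bar>det (fmat N (F Y))\<bar> \<le> fact N * 2 ^ N"
proof (rule abs_det_fmat_le)
  fix l i assume l: "l < N" and i: "i < N"
  have "\<bar>\<Sum>j<M. y l j * Y j i\<bar> \<le> (\<Sum>j<M. \<bar>y l j * Y j i\<bar>)" by (rule sum_abs)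
  also have "\<dots> \<le> (\<Sum>j<M. Y j i)"
    using Y l i y_le_1[OF l] unfolding stochastic_def
    by (intro sum_mono) (auto simp: abs_mult intro!: mult_left_le_one_le)
  also have "\<dots> = 1" using Y i by (simp add: stochastic_def)
  finally show "\<bar>F Y l i\<bar> \<le> 2" using x_le_1[OF l i] unfolding F_def by linarith
qed

text \<open>\<open>B = I + \<tau> \<Phi>\<^sub>1\<close> is the upper block of \<open>V\<^sub>0 + \<tau> \<Phi>\<close>, where \<open>V\<^sub>0\<close> belongs to the uniform
  stochastic matrix; since $\Phi^T (V_0 + \tau \Phi) = \Phi^T V_0 + \tau I$, its determinant
  vanishes for finitely many \<open>\<tau>\<close> only.\<close>

lemma det_F_nonzero: "\<exists>Y. stochastic Y \<and> det (fmat N (F Y)) \<noteq> 0"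
proof -
  define U :: "nat \<Rightarrow> nat \<Rightarrow> real" where "U = (\<lambda>j i. 1 / M)"
  \<comment> \<open>At \<tau> this polynomial is the determinant of \<tau>I + \<open>F U\<close>,
    the value to be kept away from zero.\<close>
  have "finite {\<tau>. poly (char_poly (- fmat N (F U))) \<tau> = 0}"
    using degree_monic_char_poly[of "- fmat N (F U)" N] by (intro poly_roots_finite) auto
  \<comment> \<open>Small enough for two purposes: \<tau>N \<le> 1/8 makes \<open>B\<close> a mild
    perturbation of the identity, and \<tau> \<le> 1/(8M) keeps \<open>W\<close> close to the
    uniform value 1/M.\<close>
  moreover define \<tau>0 :: real where "\<tau>0 = 1 / (8 * (N + 1) * M)"
  have \<tau>0: "0 < \<tau>0" using M_pos by (simp add: \<tau>0_def)
  then have "infinite {0<..\<tau>0}" by (simp add: infinite_Ioc)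
  ultimately have "{0<..\<tau>0} - {\<tau>. poly (char_poly (- fmat N (F U))) \<tau> = 0} \<noteq> {}"
    by (metis Diff_infinite_finite finite.emptyI)
  then obtain \<tau> where "\<tau> \<in> {0<..\<tau>0} - {\<tau>. poly (char_poly (- fmat N (F U))) \<tau> = 0}"
    by (metis ex_in_conv)
  then have \<tau>: "0 < \<tau>" "\<tau> \<le> \<tau>0" "poly (char_poly (- fmat N (F U))) \<tau> \<noteq> 0"
    by simp_all
  have "1 \<le> real M" using M_pos by simp
  have "\<tau> * (8 * (N + 1) * M) \<le> \<tau>0 * (8 * (N + 1) * M)" using \<tau>(2) by (intro mult_right_mono) auto
  also have "\<dots> = 1" using M_pos by (simp add: \<tau>0_def)
  finally have \<tau>NM: "\<tau> * (8 * (N + 1) * M) \<le> 1" .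
  have \<tau>N: "\<tau> * N \<le> 1 / 8"
  proof -
    have "\<tau> * N * 1 \<le> \<tau> * (N + 1) * M" using \<tau>(1) \<open>1 \<le> real M\<close> by (intro mult_mono) auto
    moreover have "\<tau> * (8 * (N + 1) * M) = 8 * (\<tau> * (N + 1) * M)" by simp
    ultimately show ?thesis using \<tau>NM by linarith
  qed
  define B :: "nat \<Rightarrow> nat \<Rightarrow> real" where "B = (\<lambda>k i. (if k = i then 1 else 0) + \<tau> * x i k)"
  \<comment> \<open>The negated lower block of the perturbed frame; \<open>B\<close> is its upper
    block.\<close>
  define W where "W = (\<lambda>j i. 1 / M - \<tau> * y i j)"
  have row: "(\<Sum>k<N. v k * B k i) = v i + \<tau> * (\<Sum>k<N. v k * x i k)" if "i < N" for v i
  proof -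
    have "(\<Sum>k<N. v k * B k i) = (\<Sum>k<N. (if k = i then v k else 0) + \<tau> * (v k * x i k))"
      unfolding B_def by (intro sum.cong) (auto simp: algebra_simps)
    then show ?thesis using that by (simp add: sum.distrib sum_distrib_left)
  qed
  have bound: "\<bar>\<tau> * (\<Sum>k<N. v k * x i k)\<bar> \<le> m / 8"
    if "i < N" "\<And>k. k < N \<Longrightarrow> \<bar>v k\<bar> \<le> m" "0 \<le> m" for v i m
  proof -
    have "\<bar>\<Sum>k<N. v k * x i k\<bar> \<le> (\<Sum>k<N. \<bar>v k * x i k\<bar>)" by (rule sum_abs)
    also have "\<dots> \<le> (\<Sum>k<N. m * 1)"
      unfolding abs_mult using that x_le_1[OF that(1)] by (intro sum_mono mult_mono) auto
    finally have "\<tau> * \<bar>\<Sum>k<N. v k * x i k\<bar> \<le> \<tau> * (N * m)" using \<tau>(1) by simp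
    also have "\<dots> = (\<tau> * N) * m" by simp
    also have "\<dots> \<le> 1 / 8 * m" using \<tau>N that by (intro mult_right_mono) auto
    finally show ?thesis using \<tau>(1) by (simp add: abs_mult)
  qed
  \<comment> \<open>At an entry of largest modulus m the perturbation is at most m/8, so m \<le> w +
    m/8.\<close>
  have small: "\<bar>v k\<bar> \<le> 8 / 7 * w"
    if "\<And>i. i < N \<Longrightarrow> \<bar>\<Sum>k<N. v k * B k i\<bar> \<le> w" and k: "k < N" for v k w
  proof -
    define m where "m = Max ((\<lambda>k. \<bar>v k\<bar>) ` {..<N})"
    have ne: "(\<lambda>k. \<bar>v k\<bar>) ` {..<N} \<noteq> {}" using k by auto
    obtain i where i: "i < N" "m = \<bar>v i\<bar>"
      using Max_in[OF _ ne] unfolding m_def by auto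
    have le: "\<bar>v k\<bar> \<le> m" if "k < N" for k using that by (simp add: m_def)
    have "\<bar>v i + \<tau> * (\<Sum>k<N. v k * x i k)\<bar> \<le> w" using that(1)[OF i(1)] row[OF i(1)] by simp
    moreover have "\<bar>\<tau> * (\<Sum>k<N. v k * x i k)\<bar> \<le> m / 8" using i by (intro bound le) auto
    ultimately have "m \<le> 8 / 7 * w" unfolding i(2) by linarith
    then show ?thesis using le[OF k] by simp
  qed
  have "det (fmat N B) \<noteq> 0"
    unfolding det_fmat_nonzero_iff using small[where w = 0] by auto
  then obtain Y where Y: "stochastic Y"
    "\<And>j i. j < M \<Longrightarrow> i < N \<Longrightarrow> (\<Sum>k<N. Y j k * B k i) = W j i"
  proof (rule stochastic_quotient)
    fix v j i assume j: "j < M" and v: "\<forall>i<N. (\<Sum>k<N. v k * B k i) = W j i" and i: "i < N"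
    have \<tau>M: "\<tau> \<le> 1 / (8 * real M)"
    proof -
      have "\<tau> * (1 * (8 * M)) \<le> \<tau> * ((N + 1) * (8 * M))"
        using \<tau>(1) by (intro mult_left_mono mult_right_mono) auto
      then show ?thesis using \<tau>NM M_pos by (simp add: field_simps)
    qed
    have W: "\<bar>W j i - 1 / M\<bar> \<le> 1 / (8 * real M)" if "i < N" for i
    proof -
      have "\<tau> * \<bar>y i j\<bar> \<le> \<tau>" using \<tau>(1) y_le_1[OF that j] by (simp add: mult_left_le)
      then have "\<tau> * \<bar>y i j\<bar> \<le> 1 / (8 * real M)" using \<tau>M by (rule order_trans)
      then show ?thesis using \<tau>(1) by (simp add: W_def abs_mult)
    qed
    \<comment> \<open>In units of b the entries of \<open>W\<close> lie between 7 and 9. Hence a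
      solution has entries of modulus at most 72/7, the perturbation is at most 9/7, and 7 - 9/7
      remains positive.\<close>
    define b where "b = 1 / (8 * real M)"
    have b: "0 < b" "1 / real M = 8 * b" using M_pos by (auto simp: b_def)
    have "\<bar>W j i\<bar> \<le> 9 * b" if "i < N" for i
      using W[OF that] unfolding b_def[symmetric] b(2) by linarith
    then have "\<bar>v k\<bar> \<le> 8 / 7 * (9 * b)" if "k < N" for k using v that by (intro small) auto
    then have "\<bar>\<tau> * (\<Sum>k<N. v k * x i k)\<bar> \<le> (8 / 7 * (9 * b)) / 8"
      using i b by (intro bound) auto
    moreover have "v i + \<tau> * (\<Sum>k<N. v k * x i k) = W j i" using v i row by simp
    ultimately show "0 \<le> v i" using W[OF i] b(1) unfolding b_def[symmetric] b(2) by linarith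
  next
    fix i assume i: "i < N"
    have "(\<Sum>j<M. y i j) = - (\<Sum>k<N. x i k)" using sum_zero[OF i] by linarith
    then show "(\<Sum>k<N. B k i) = (\<Sum>j<M. W j i)"
      using row[OF i, of "\<lambda>_. 1"] M_pos by (simp add: W_def sum_subtractf flip: sum_distrib_left)
  qed blast
  have "(\<Sum>k<N. F Y l k * B k i) = (if l = i then \<tau> else 0) + F U l i" if "l < N" "i < N" for l i
  proof -
    have "(\<Sum>k<N. F Y l k * B k i) = (\<Sum>k<N. x l k * B k i) - (\<Sum>j<M. y l j * W j i)"
      by (rule F_times[OF Y(2) that(2)])
    also have "\<dots> = x l i - (\<Sum>j<M. y l j * U j i)
        + \<tau> * ((\<Sum>k<N. x l k * x i k) + (\<Sum>j<M. y l j * y i j))"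
      unfolding row[OF that(2)] W_def U_def
      by (simp add: algebra_simps sum_subtractf sum_distrib_left)
    finally show ?thesis unfolding orthonormal[OF that] by (simp add: F_def)
  qed
  then have "fmat N (\<lambda>l i. \<Sum>k<N. F Y l k * B k i) = \<tau> \<cdot>\<^sub>m 1\<^sub>m N - (- fmat N (F U))"
    by (intro eq_matI) auto
  then have "det (fmat N (F Y)) * det (fmat N B) = det (\<tau> \<cdot>\<^sub>m 1\<^sub>m N - (- fmat N (F U)))"
    by (simp flip: det_fmat_mult)
  moreover have "poly (char_poly (- fmat N (F U))) \<tau> = det (\<tau> \<cdot>\<^sub>m 1\<^sub>m N - (- fmat N (F U)))"
    by (subst char_poly_matrix[of _ N])
      (auto simp: char_matrix_def intro!: arg_cong[where f = det] eq_matI)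
  ultimately show ?thesis using \<tau>(3) Y(1) by auto
qed

theorem sum_eigenvalues_le: "(\<Sum>l<N. \<mu> l) \<le> (real N)\<^sup>2 + (\<Sum>i<N. d i)"
proof -
  define S where "S = {\<bar>det (fmat N (F Y))\<bar> | Y. stochastic Y}"
  define s where "s = Sup S"
  have bdd: "bdd_above S" unfolding S_def by (rule bdd_aboveI) (auto intro: abs_det_F_le)
  have le_s: "\<bar>det (fmat N (F Y))\<bar> \<le> s" if "stochastic Y" for Y
    unfolding s_def using that by (intro cSup_upper[OF _ bdd]) (auto simp: S_def)
  obtain Y0 where Y0: "stochastic Y0" "det (fmat N (F Y0)) \<noteq> 0" using det_F_nonzero by blast
  then have s: "0 < s" using le_s[OF Y0(1)] by simp
  define c where "c = (real N)\<^sup>2 + (\<Sum>i<N. d i)"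
  have c: "0 \<le> c" unfolding c_def using d_bounds(1) by (auto intro!: add_nonneg_nonneg sum_nonneg)
  define K where "K = fact N * (1 + real N + M) ^ N"
  have main: "(\<Prod>l<N. 1 + \<epsilon> * \<mu> l) \<le> exp (\<epsilon> * c) + \<epsilon>\<^sup>2 * K" if \<epsilon>: "0 < \<epsilon>" "\<epsilon> \<le> 1" for \<epsilon>
  proof -
    let ?p = "\<Prod>l<N. 1 + \<epsilon> * \<mu> l" and ?b = "exp (\<epsilon> * c) + \<epsilon>\<^sup>2 * K"
    have p: "0 < ?p" using \<epsilon> \<mu>_nonneg by (intro prod_pos) (auto simp: add_pos_nonneg)
    have b: "0 \<le> ?b" by (auto simp: K_def intro!: add_nonneg_nonneg)
    have "r \<le> s * ?b / ?p" if r: "r \<in> S" for r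
    proof -
      obtain Y where Y: "stochastic Y" and r: "r = \<bar>det (fmat N (F Y))\<bar>" using r by (auto simp: S_def)
      obtain Y' where Y': "stochastic Y'" and eq:
        "?p * det (fmat N (F Y)) = det (fmat N (F Y')) * det (fmat N (X \<epsilon> Y))"
        using det_F_step[OF Y \<epsilon>(1)] by blast
      have det_X: "\<bar>det (fmat N (X \<epsilon> Y))\<bar> \<le> ?b"
        using abs_det_X_le[OF Y \<epsilon>] by (simp add: c_def K_def algebra_simps)
      have "?p * r = \<bar>?p * det (fmat N (F Y))\<bar>" using p by (simp add: r abs_mult)
      also have "\<dots> = \<bar>det (fmat N (F Y'))\<bar> * \<bar>det (fmat N (X \<epsilon> Y))\<bar>" by (simp add: eq abs_mult)
      also have "\<dots> \<le> s * ?b" using le_s[OF Y'] det_X s by (intro mult_mono) auto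
      finally show ?thesis using p by (simp add: field_simps)
    qed
    moreover have "S \<noteq> {}" using Y0 by (auto simp: S_def)
    \<comment> \<open>The frame Y' is again stochastic, so its determinant is bounded by
      \<open>s\<close> too; taking the supremum over all Y leaves \<open>s\<close> on both sides, to
      be cancelled.\<close>
    ultimately have "s \<le> s * ?b / ?p" unfolding s_def[symmetric] unfolding s_def by (intro cSup_least)
    then have "s * ?p \<le> s * ?b" using p by (simp add: pos_le_divide_eq)
    then show ?thesis using s by (simp only: mult_le_cancel_left_pos)
  qed
  have "(\<Sum>l<N. \<mu> l) \<le> c + \<delta>" if \<delta>: "0 < \<delta>" for \<delta>
  proof -
    define \<epsilon> where "\<epsilon> = min (1 / (1 + c)) (\<delta> / (1 + c\<^sup>2 + K))"
    have K: "0 \<le> K" by (simp add: K_def)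
    have pos: "0 < 1 + c\<^sup>2 + K" using K by (simp add: add_pos_nonneg)
    have \<epsilon>: "0 < \<epsilon>" "\<epsilon> \<le> 1 / (1 + c)" "\<epsilon> \<le> \<delta> / (1 + c\<^sup>2 + K)"
      using \<delta> c pos by (auto simp: \<epsilon>_def)
    have "1 / (1 + c) \<le> 1" using c by simp
    then have \<epsilon>1: "\<epsilon> \<le> 1" using \<epsilon>(2) by linarith
    have "\<epsilon> * c \<le> 1"
      using \<epsilon>(1,2) c by (simp add: field_simps)
    then have "exp (\<epsilon> * c) \<le> 1 + \<epsilon> * c + (\<epsilon> * c)\<^sup>2"
      using \<epsilon>(1) c by (intro exp_bound) auto
    moreover have "1 + (\<Sum>l<N. \<epsilon> * \<mu> l) \<le> (\<Prod>l<N. 1 + \<epsilon> * \<mu> l)"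
      using \<epsilon>(1) \<mu>_nonneg by (intro one_plus_sum_le_prod) auto
    ultimately have "\<epsilon> * (\<Sum>l<N. \<mu> l) \<le> \<epsilon> * (c + \<epsilon> * (c\<^sup>2 + K))"
      using main[OF \<epsilon>(1) \<epsilon>1] by (simp add: sum_distrib_left algebra_simps power2_eq_square)
    then have "(\<Sum>l<N. \<mu> l) \<le> c + \<epsilon> * (c\<^sup>2 + K)" using \<epsilon>(1) by simp
    also have "\<epsilon> * (c\<^sup>2 + K) \<le> \<epsilon> * (1 + c\<^sup>2 + K)" using \<epsilon>(1) by simp
    also have "\<dots> \<le> \<delta>" using \<epsilon>(3) pos by (simp add: field_simps)
    finally show ?thesis by simp
  qed
  then show ?thesis unfolding c_def[symmetric] by (rule field_le_epsilon)
qed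

end

section \<open>Orthonormal families and the Laplacian spectrum\<close>

text \<open>Vectors are total functions of which only the values on \<open>X\<close> count.\<close>

definition ip :: "'a set \<Rightarrow> ('a \<Rightarrow> real) \<Rightarrow> ('a \<Rightarrow> real) \<Rightarrow> real" where
  "ip X u v = (\<Sum>x\<in>X. u x * v x)"

definition orthonormal_on :: "'a set \<Rightarrow> nat \<Rightarrow> (nat \<Rightarrow> 'a \<Rightarrow> real) \<Rightarrow> bool" where
  "orthonormal_on X k u \<longleftrightarrow> (\<forall>i<k. \<forall>j<k. ip X (u i) (u j) = (if i = j then 1 else 0))"

lemma ip_commute: "ip X u v = ip X v u"
  by (simp add: ip_def mult.commute)

lemma ip_add_left: "ip X (\<lambda>x. u x + v x) w = ip X u w + ip X v w"
  by (simp add: ip_def distrib_right sum.distrib)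

lemma ip_diff_left: "ip X (\<lambda>x. u x - v x) w = ip X u w - ip X v w"
  by (simp add: ip_def left_diff_distrib sum_subtractf)

lemma ip_scale_left: "ip X (\<lambda>x. c * u x) w = c * ip X u w"
  by (simp add: ip_def sum_distrib_left mult.assoc)

lemma ip_sum_left: "ip X (\<lambda>x. \<Sum>i\<in>I. c i * u i x) w = (\<Sum>i\<in>I. c i * ip X (u i) w)"
  unfolding ip_def sum_distrib_left sum_distrib_right
  by (subst sum.swap) (simp add: mult.assoc)

lemma ip_add_right: "ip X w (\<lambda>x. u x + v x) = ip X w u + ip X w v"
  and ip_diff_right: "ip X w (\<lambda>x. u x - v x) = ip X w u - ip X w v"
  and ip_scale_right: "ip X w (\<lambda>x. c * u x) = c * ip X w u"
  and ip_sum_right: "ip X w (\<lambda>x. \<Sum>i\<in>I. d i * v' i x) = (\<Sum>i\<in>I. d i * ip X w (v' i))"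
  by (simp_all add: ip_commute[of X w] ip_add_left ip_diff_left ip_scale_left ip_sum_left)

lemma ip_self_nonneg: "0 \<le> ip X u u"
  by (simp add: ip_def sum_nonneg)

lemma ip_self_eq_0: "finite X \<Longrightarrow> ip X u u = 0 \<Longrightarrow> x \<in> X \<Longrightarrow> u x = 0"
  by (simp add: ip_def sum_nonneg_eq_0_iff)

lemma ip_cong: "(\<And>x. x \<in> X \<Longrightarrow> u x = u' x) \<Longrightarrow> (\<And>x. x \<in> X \<Longrightarrow> v x = v' x) \<Longrightarrow> ip X u v = ip X u' v'"
  by (simp add: ip_def)

lemma ip_delta: "finite X \<Longrightarrow> y \<in> X \<Longrightarrow> ip X u (\<lambda>x. if x = y then 1 else 0) = u y"
  by (simp add: ip_def if_distrib[of "(*) _"] cong: if_cong)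

lemma orthonormal_onD:
  "orthonormal_on X k u \<Longrightarrow> i < k \<Longrightarrow> j < k \<Longrightarrow> ip X (u i) (u j) = (if i = j then 1 else 0)"
  by (simp add: orthonormal_on_def)

definition residual :: "'a set \<Rightarrow> nat \<Rightarrow> (nat \<Rightarrow> 'a \<Rightarrow> real) \<Rightarrow> ('a \<Rightarrow> real) \<Rightarrow> 'a \<Rightarrow> real" where
  "residual X k u b x = b x - (\<Sum>i<k. ip X (u i) b * u i x)"

lemma ip_residual:
  assumes "orthonormal_on X k u" and "j < k"
  shows "ip X (u j) (residual X k u b) = 0"
proof -
  have "(\<Sum>i<k. ip X (u i) b * ip X (u j) (u i)) = (\<Sum>i<k. if j = i then ip X (u j) b else 0)"
    using assms by (intro sum.cong) (auto simp: orthonormal_onD)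
  then show ?thesis
    using assms unfolding residual_def ip_diff_right ip_sum_right by simp
qed

text \<open>Pythagoras: the residual is orthogonal to every \<open>u i\<close>.\<close>

lemma ip_residual_self:
  assumes "orthonormal_on X k u"
  shows "ip X (residual X k u b) (residual X k u b) = ip X b b - (\<Sum>i<k. (ip X (u i) b)\<^sup>2)"
proof -
  let ?r = "residual X k u b"
  have "ip X ?r ?r = ip X (\<lambda>x. b x - (\<Sum>i<k. ip X (u i) b * u i x)) ?r"
    unfolding residual_def[abs_def] ..
  also have "\<dots> = ip X b ?r"
    unfolding ip_diff_left ip_sum_left using ip_residual[OF assms] by simp
  also have "\<dots> = ip X b b - (\<Sum>i<k. (ip X (u i) b)\<^sup>2)"
    unfolding residual_def ip_diff_right ip_sum_right
    by (simp add: ip_commute[of X b "u _"] power2_eq_square)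
  finally show ?thesis .
qed

lemma bessel:
  "orthonormal_on X k u \<Longrightarrow> (\<Sum>i<k. (ip X (u i) b)\<^sup>2) \<le> ip X b b"
  using ip_residual_self[of X k u b] ip_self_nonneg[of X "residual X k u b"] by simp

lemma bessel_delta:
  assumes "finite X" "orthonormal_on X k u" "x \<in> X"
  shows "(\<Sum>i<k. (u i x)\<^sup>2) \<le> 1"
  using bessel[OF assms(2), of "\<lambda>y. if y = x then 1 else 0"] assms
  by (simp add: ip_delta)

lemma sum_orthonormal_squares:
  assumes "orthonormal_on X k u"
  shows "(\<Sum>x\<in>X. \<Sum>i<k. (u i x)\<^sup>2) = k"
proof -
  have "(\<Sum>x\<in>X. \<Sum>i<k. (u i x)\<^sup>2) = (\<Sum>i<k. ip X (u i) (u i))"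
    unfolding ip_def by (subst sum.swap) (simp add: power2_eq_square)
  also have "\<dots> = k" using assms by (simp add: orthonormal_onD)
  finally show ?thesis .
qed

text \<open>Counting replaces dimension theory. The sums of squares over the family are at most 1 at
  each point and add up to \<open>card X\<close>, so they all equal 1; thus every point mass has
  residual of norm 0.\<close>

lemma orthonormal_complete:
  assumes X: "finite X" and u: "orthonormal_on X (card X) u" and x: "x \<in> X"
  shows "(\<Sum>i<card X. ip X (u i) b * u i x) = b x"
proof -
  let ?n = "card X"
  have delta: "(\<Sum>i<?n. u i y * u i x) = (if y = x then 1 else 0)" if y: "y \<in> X" for y
  proof -
    let ?\<delta> = "\<lambda>y. if y = x then 1 else 0 :: real"
    have "\<forall>x\<in>X. (\<Sum>i<?n. (u i x)\<^sup>2) = 1"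
    proof (rule ccontr)
      assume "\<not> (\<forall>x\<in>X. (\<Sum>i<?n. (u i x)\<^sup>2) = 1)"
      then obtain z where "z \<in> X" "(\<Sum>i<?n. (u i z)\<^sup>2) < 1"
        using bessel_delta[OF X u] by (auto simp: less_le)
      then have "(\<Sum>x\<in>X. \<Sum>i<?n. (u i x)\<^sup>2) < (\<Sum>x\<in>X. 1)"
        using X bessel_delta[OF X u] by (intro sum_strict_mono_ex1) auto
      then show False using sum_orthonormal_squares[OF u] by simp
    qed
    then have "ip X (residual X ?n u ?\<delta>) (residual X ?n u ?\<delta>) = 0"
      using x X by (simp add: ip_residual_self[OF u] ip_delta)
    then have "residual X ?n u ?\<delta> y = 0" by (rule ip_self_eq_0[OF X _ y])
    then show ?thesis using x X by (simp add: residual_def ip_delta mult.commute)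
  qed
  have "(\<Sum>i<?n. ip X (u i) b * u i x) = (\<Sum>y\<in>X. b y * (\<Sum>i<?n. u i y * u i x))"
    unfolding ip_def sum_distrib_left sum_distrib_right
    by (subst sum.swap) (simp add: mult_ac)
  also have "\<dots> = (\<Sum>y\<in>X. b y * (if y = x then 1 else 0))" by (rule sum.cong) (auto simp: delta)
  also have "\<dots> = b x" using X x by (simp add: if_distrib[of "(*) _"] cong: if_cong)
  finally show ?thesis .
qed

lemma parseval:
  assumes "finite X" and "orthonormal_on X (card X) u"
  shows "(\<Sum>i<card X. (ip X (u i) b)\<^sup>2) = ip X b b"
proof -
  have "ip X b b = ip X (\<lambda>x. \<Sum>i<card X. ip X (u i) b * u i x) b"
    by (rule ip_cong) (simp_all add: orthonormal_complete[OF assms])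
  then show ?thesis unfolding ip_sum_left by (simp add: power2_eq_square)
qed

text \<open>By the same count, k < \<open>card X\<close> leaves a point where the sum of squares is
  below 1; the residual of its point mass is nonzero and can be normalized.\<close>

lemma exists_orthogonal_unit:
  assumes X: "finite X" and u: "orthonormal_on X k u" and k: "k < card X"
  obtains v where "ip X v v = 1" "\<And>i. i < k \<Longrightarrow> ip X (u i) v = 0"
proof -
  obtain x where x: "x \<in> X" "(\<Sum>i<k. (u i x)\<^sup>2) < 1"
  proof (rule ccontr)
    assume "\<not> thesis"
    then have "(\<Sum>x\<in>X. 1) \<le> (\<Sum>x\<in>X. \<Sum>i<k. (u i x)\<^sup>2)" using that by (intro sum_mono) force
    then show False using sum_orthonormal_squares[OF u] k by simp
  qed
  define r where "r = residual X k u (\<lambda>y. if y = x then 1 else 0)"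
  have pos: "0 < ip X r r"
    using x X by (simp add: r_def ip_residual_self[OF u] ip_delta)
  show ?thesis
  proof (rule that[of "\<lambda>y. (1 / sqrt (ip X r r)) * r y"])
    show "ip X (\<lambda>y. (1 / sqrt (ip X r r)) * r y) (\<lambda>y. (1 / sqrt (ip X r r)) * r y) = 1"
      unfolding ip_scale_left ip_scale_right using pos by simp
    show "ip X (u i) (\<lambda>y. (1 / sqrt (ip X r r)) * r y) = 0" if "i < k" for i
      unfolding ip_scale_right using ip_residual[OF u that] by (simp add: r_def)
  qed
qed

section \<open>The Dirichlet form and an eigenbasis of the Laplacian\<close>

definition laplace :: "('a \<times> 'a) set \<Rightarrow> ('a \<Rightarrow> real) \<Rightarrow> 'a \<Rightarrow> real" where
  "laplace E u x = (\<Sum>y\<in>E `` {x}. u x - u y)"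

text \<open>Each undirected edge occurs in \<open>E\<close> in both directions, hence the division
  by two.\<close>

definition dirichlet :: "('a \<times> 'a) set \<Rightarrow> ('a \<Rightarrow> real) \<Rightarrow> real" where
  "dirichlet E u = (\<Sum>(x, y)\<in>E. (u x - u y)\<^sup>2) / 2"

locale finite_sym_graph =
  fixes X :: "'a set" and E :: "('a \<times> 'a) set"
  assumes finite_X: "finite X" and E_subset: "E \<subseteq> X \<times> X" and sym_E: "sym E"
begin

abbreviation lap :: "('a \<Rightarrow> real) \<Rightarrow> 'a \<Rightarrow> real" where
  "lap \<equiv> laplace E"

abbreviation q :: "('a \<Rightarrow> real) \<Rightarrow> real" where
  "q \<equiv> dirichlet E"

lemma finite_E: "finite E"
  using finite_subset[OF E_subset] finite_X by simp

lemma sum_E_swap: "(\<Sum>(x, y)\<in>E. f x y) = (\<Sum>(x, y)\<in>E. f y x)"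
  by (rule sum.reindex_bij_witness[of _ prod.swap prod.swap])
    (use sym_E in \<open>auto simp: sym_def\<close>)

lemma sum_E_iterated: "(\<Sum>x\<in>X. \<Sum>y\<in>E `` {x}. f x y) = (\<Sum>(x, y)\<in>E. f x y)"
proof -
  have "(SIGMA x:X. E `` {x}) = E" using E_subset by auto
  moreover have "finite (E `` {x})" for x
    using finite_subset[OF _ finite_X, of "E `` {x}"] E_subset by auto
  ultimately show ?thesis using finite_X by (simp add: sum.Sigma)
qed

text \<open>Summation by parts: average the sum over all arcs with the sum over the reversed
  arcs.\<close>

lemma ip_lap: "ip X (lap u) v = (\<Sum>(x, y)\<in>E. (u x - u y) * (v x - v y)) / 2"
proof -
  have "ip X (lap u) v = (\<Sum>x\<in>X. \<Sum>y\<in>E `` {x}. (u x - u y) * v x)"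
    unfolding ip_def laplace_def sum_distrib_right ..
  also have "\<dots> = (\<Sum>(x, y)\<in>E. (u x - u y) * v x)" by (rule sum_E_iterated)
  finally have 1: "ip X (lap u) v = (\<Sum>(x, y)\<in>E. (u x - u y) * v x)" .
  also have "\<dots> = (\<Sum>(x, y)\<in>E. (u y - u x) * v y)" by (rule sum_E_swap)
  finally have 2: "ip X (lap u) v = (\<Sum>(x, y)\<in>E. (u y - u x) * v y)" .
  have "2 * ip X (lap u) v = (\<Sum>(x, y)\<in>E. (u x - u y) * (v x - v y))"
    unfolding mult_2 by (subst 1, subst 2)
      (auto simp: sum.distrib[symmetric] algebra_simps intro!: sum.cong)
  then show ?thesis by simp
qed

lemma ip_lap_commute: "ip X (lap u) v = ip X u (lap v)"
  unfolding ip_commute[of X u] ip_lap by (simp add: mult.commute)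

lemma q_eq: "q u = ip X (lap u) u"
  unfolding ip_lap dirichlet_def by (simp add: power2_eq_square)

lemma q_nonneg: "0 \<le> q u"
  unfolding dirichlet_def by (auto intro!: sum_nonneg)

lemma q_scale: "q (\<lambda>x. c * u x) = c\<^sup>2 * q u"
  unfolding dirichlet_def sum_distrib_left times_divide_eq_right
  by (auto intro!: arg_cong2[where f = "(/)"] sum.cong simp: power_mult_distrib[symmetric] algebra_simps)

lemma q_cong: "(\<And>x. x \<in> X \<Longrightarrow> u x = v x) \<Longrightarrow> q u = q v"
  unfolding dirichlet_def using E_subset by (auto intro!: arg_cong2[where f = "(/)"] sum.cong)

lemma q_add: "q (\<lambda>x. u x + t * v x) = q u + 2 * t * ip X (lap u) v + t\<^sup>2 * q v"
proof -
  have "(\<Sum>(x, y)\<in>E. (u x + t * v x - (u y + t * v y))\<^sup>2)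
    = (\<Sum>(x, y)\<in>E. (u x - u y)\<^sup>2 + 2 * t * ((u x - u y) * (v x - v y)) + t\<^sup>2 * (v x - v y)\<^sup>2)"
    by (intro sum.cong) (auto simp: power2_eq_square algebra_simps)
  also have "\<dots> = (\<Sum>(x, y)\<in>E. (u x - u y)\<^sup>2) + 2 * t * (\<Sum>(x, y)\<in>E. (u x - u y) * (v x - v y))
      + t\<^sup>2 * (\<Sum>(x, y)\<in>E. (v x - v y)\<^sup>2)"
    by (simp add: sum.distrib split_def sum_distrib_left)
  finally show ?thesis unfolding dirichlet_def ip_lap by (simp add: add_divide_distrib)
qed

text \<open>A continuous function attains its maximum on the compact set of admissible unit vectors;
  homogeneity extends the inequality to all admissible vectors.\<close>

lemma rayleigh_maximizer:
  assumes u: "orthonormal_on X k u" and k: "k < card X"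
  obtains w where "ip X w w = 1" "\<And>i. i < k \<Longrightarrow> ip X (u i) w = 0"
    "\<And>v. (\<And>i. i < k \<Longrightarrow> ip X (u i) v = 0) \<Longrightarrow> q v \<le> q w * ip X v v"
proof -
  \<comment> \<open>Coordinates outside \<open>X\<close> are pinned to 0 and unit vectors have
    coordinates in [-1, 1], so the search takes place in a product of compact sets.\<close>
  define B where "B = (\<lambda>x. if x \<in> X then {-1..1} else {0 :: real})"
  define S where "S = Pi\<^sub>E UNIV B \<inter> {w. ip X w w = 1} \<inter> {w. \<forall>i<k. ip X (u i) w = 0}"
  have cont_ip: "continuous_on UNIV (\<lambda>w. ip X v w)" "continuous_on UNIV (\<lambda>w. ip X w w)" for v
    unfolding ip_def by (intro continuous_intros continuous_on_product_coordinates)+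
  have "compactin (product_topology (\<lambda>_. euclidean) UNIV) (Pi\<^sub>E UNIV B)"
    unfolding compactin_PiE by (auto simp: B_def)
  then have "compact (Pi\<^sub>E UNIV B)" by (simp add: euclidean_product_topology)
  moreover have "closed {w. ip X w w = 1}"
    by (intro closed_Collect_eq cont_ip continuous_on_const)
  moreover have "closed {w. \<forall>i<k. ip X (u i) w = 0}"
    by (intro closed_Collect_all closed_Collect_imp closed_Collect_eq cont_ip continuous_on_const) auto
  ultimately have "compact S" unfolding S_def by (intro compact_Int_closed)
  define N where "N = (\<lambda>v x. if x \<in> X then (1 / sqrt (ip X v v)) * v x else 0)"
  have ipN: "ip X w (N v) = (1 / sqrt (ip X v v)) * ip X w v"
    and qN: "q (N v) = (1 / sqrt (ip X v v))\<^sup>2 * q v" for v w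
    unfolding ip_scale_right[symmetric] q_scale[symmetric]
    by (auto simp: N_def intro!: ip_cong q_cong)
  have NS: "N v \<in> S" if "0 < ip X v v" "\<And>i. i < k \<Longrightarrow> ip X (u i) v = 0" for v
  proof -
    have one: "ip X (N v) (N v) = 1"
      using that unfolding ipN ip_commute[of X "N v"] by simp
    have "\<bar>N v x\<bar> \<le> 1" if "x \<in> X" for x
    proof -
      have "(N v x)\<^sup>2 \<le> (\<Sum>x\<in>X. (N v x)\<^sup>2)" using that finite_X by (intro member_le_sum) auto
      then show ?thesis using one by (simp add: ip_def power2_eq_square[symmetric] abs_square_le_1)
    qed
    then have "N v x \<in> B x" for x
      by (cases "x \<in> X") (auto simp: B_def abs_le_iff, simp add: N_def)
    then show ?thesis using one that by (auto simp: S_def ipN)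
  qed
  obtain v0 where "ip X v0 v0 = 1" "\<And>i. i < k \<Longrightarrow> ip X (u i) v0 = 0"
    using exists_orthogonal_unit[OF finite_X u k] by blast
  then have "S \<noteq> {}" using NS[of v0] by auto
  moreover have "continuous_on S q"
    unfolding dirichlet_def split_def
    by (intro continuous_intros continuous_on_subset[OF continuous_on_product_coordinates] subset_UNIV) auto
  ultimately obtain w where w: "w \<in> S" and max: "\<And>v. v \<in> S \<Longrightarrow> q v \<le> q w"
    using continuous_attains_sup[OF \<open>compact S\<close>] by metis
  show ?thesis
  proof (rule that)
    show "ip X w w = 1" "\<And>i. i < k \<Longrightarrow> ip X (u i) w = 0" using w by (auto simp: S_def)
    fix v assume v: "\<And>i. i < k \<Longrightarrow> ip X (u i) v = 0"
    show "q v \<le> q w * ip X v v"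
    proof (cases "ip X v v = 0")
      case True
      then have "q v = q (\<lambda>x. 0 * v x)" using ip_self_eq_0[OF finite_X True] by (intro q_cong) auto
      then show ?thesis using True q_scale[of 0 v] by simp
    next
      case False
      then have pos: "0 < ip X v v" using ip_self_nonneg[of X v] by simp
      then have "q (N v) \<le> q w" using v by (intro max NS)
      then show ?thesis unfolding qN using pos by (simp add: power_divide field_simps)
    qed
  qed
qed

text \<open>First variation in the direction of the defect g = Lw - q(w)w. It is an admissible
  direction, being orthogonal to the earlier eigenvectors, and the derivative there is twice the
  squared norm of g, which must therefore vanish.\<close>

lemma maximizer_eigenvector:
  assumes w: "ip X w w = 1" "\<And>i. i < k \<Longrightarrow> ip X (u i) w = 0"
    and max: "\<And>v. (\<And>i. i < k \<Longrightarrow> ip X (u i) v = 0) \<Longrightarrow> q v \<le> q w * ip X v v"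
    and eigen: "\<And>i x. i < k \<Longrightarrow> x \<in> X \<Longrightarrow> lap (u i) x = \<mu> i * u i x"
    and x: "x \<in> X"
  shows "lap w x = q w * w x"
proof -
  define g where "g = (\<lambda>x. lap w x - q w * w x)"
  have gu: "ip X (u i) g = 0" if "i < k" for i
  proof -
    have "ip X (u i) (lap w) = ip X (\<lambda>x. \<mu> i * u i x) w"
      unfolding ip_lap_commute[symmetric] using eigen[OF that] by (intro ip_cong) auto
    then show ?thesis unfolding g_def ip_diff_right ip_scale_right ip_scale_left using w that by simp
  qed
  have quad: "2 * t * ip X g g + t\<^sup>2 * (q g - q w * ip X g g) \<le> 0" for t
  proof -
    have "q (\<lambda>x. w x + t * g x) \<le> q w * ip X (\<lambda>x. w x + t * g x) (\<lambda>x. w x + t * g x)"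
      using w gu by (intro max) (simp add: ip_add_right ip_scale_right)
    also have "ip X (\<lambda>x. w x + t * g x) (\<lambda>x. w x + t * g x)
        = 1 + 2 * t * ip X w g + t\<^sup>2 * ip X g g"
      using w by (simp add: ip_add_left ip_add_right ip_scale_left ip_scale_right ip_commute[of X g w]
          power2_eq_square algebra_simps)
    finally have "2 * t * (ip X (lap w) g - q w * ip X w g) + t\<^sup>2 * (q g - q w * ip X g g) \<le> 0"
      unfolding q_add by (simp add: algebra_simps)
    moreover have "ip X (lap w) g - q w * ip X w g = ip X g g"
      unfolding g_def ip_diff_left ip_scale_left ..
    ultimately show ?thesis by simp
  qed
  have "ip X g g = 0"
  proof (rule ccontr)
    assume "ip X g g \<noteq> 0"
    then have pos: "0 < ip X g g" using ip_self_nonneg[of X g] by simp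
    define c where "c = \<bar>q g - q w * ip X g g\<bar> + 1"
    have c: "0 < c" by (simp add: c_def)
    \<comment> \<open>For this t the quadratic term is smaller in modulus than half of the linear
      term, so the sum is positive.\<close>
    define t where "t = ip X g g / c"
    have t: "0 < t" "t * c = ip X g g" using pos c by (auto simp: t_def)
    have "t * (- c) \<le> t * (q g - q w * ip X g g)"
      using t(1) by (intro mult_left_mono) (auto simp: c_def)
    then have "0 < 2 * ip X g g + t * (q g - q w * ip X g g)" using t pos by simp
    then have "0 < t * (2 * ip X g g + t * (q g - q w * ip X g g))" using t(1) by (rule mult_pos_pos[rotated])
    then show False using quad[of t] by (simp add: power2_eq_square algebra_simps)
  qed
  then have "g x = 0" using ip_self_eq_0[OF finite_X _ x] by blast
  then show ?thesis by (simp add: g_def)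
qed

text \<open>The last vector is fixed to be the normalized constant. Thus all others sum to zero,
  even if the eigenvalue 0 is multiple.\<close>

definition eigenbasis :: "(nat \<Rightarrow> 'a \<Rightarrow> real) \<Rightarrow> (nat \<Rightarrow> real) \<Rightarrow> bool" where
  "eigenbasis u \<mu> \<longleftrightarrow> orthonormal_on X (card X) u \<and>
    (\<forall>i<card X. \<forall>x\<in>X. lap (u i) x = \<mu> i * u i x) \<and>
    (\<forall>i<card X. \<forall>j\<le>i. \<mu> i \<le> \<mu> j) \<and> (\<forall>x\<in>X. u (card X - 1) x = 1 / sqrt (card X))"

lemma eigenvalue_eq_q:
  assumes "orthonormal_on X k u" "i < k" "\<And>x. x \<in> X \<Longrightarrow> lap (u i) x = \<mu> * u i x"
  shows "\<mu> = q (u i)"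
proof -
  have "q (u i) = ip X (\<lambda>x. \<mu> * u i x) (u i)" unfolding q_eq using assms by (intro ip_cong) auto
  then show ?thesis using assms by (simp add: ip_scale_left orthonormal_onD)
qed

text \<open>Start with the constant vector, add successive maximizers of the Rayleigh quotient, and
  finally move the constant vector to the end; its eigenvalue 0 is smallest because \<open>q\<close>
  is nonnegative.\<close>

lemma eigenbasis_exists:
  assumes ne: "X \<noteq> {}"
  shows "\<exists>u \<mu>. eigenbasis u \<mu>"
proof -
  let ?n = "card X"
  have n: "0 < ?n" using ne finite_X by (simp add: card_gt_0_iff)
  \<comment> \<open>Maximality is claimed for \<open>0 < i\<close> only: the constant vector at
    index 0 is prescribed, not found by maximization.\<close>
  define P where "P = (\<lambda>k u. orthonormal_on X (Suc k) u \<and>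
      (\<forall>i\<le>k. \<forall>x\<in>X. lap (u i) x = q (u i) * u i x) \<and>
      (\<forall>i\<le>k. 0 < i \<longrightarrow> (\<forall>v. (\<forall>j<i. ip X (u j) v = 0) \<longrightarrow> q v \<le> q (u i) * ip X v v)) \<and>
      u 0 = (\<lambda>x. 1 / sqrt ?n))"
  have chain: "\<exists>u. P k u" if "k < ?n" for k
    using that
  proof (induction k)
    case 0
    let ?u = "\<lambda>_ x. 1 / sqrt ?n"
    have "ip X (?u 0) (?u 0) = 1" using n by (simp add: ip_def)
    moreover have "q (?u 0) = 0" "lap (?u 0) x = 0" for x by (simp_all add: dirichlet_def laplace_def)
    ultimately have "P 0 ?u" by (simp add: P_def orthonormal_on_def)
    then show ?case by blast
  next
    case (Suc k)
    then obtain u where u: "P k u" by auto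
    then have on: "orthonormal_on X (Suc k) u"
      and ev: "\<And>i x. i < Suc k \<Longrightarrow> x \<in> X \<Longrightarrow> lap (u i) x = q (u i) * u i x"
      by (auto simp: P_def)
    obtain w where w: "ip X w w = 1" "\<And>i. i < Suc k \<Longrightarrow> ip X (u i) w = 0"
      and max: "\<And>v. (\<And>i. i < Suc k \<Longrightarrow> ip X (u i) v = 0) \<Longrightarrow> q v \<le> q w * ip X v v"
      using rayleigh_maximizer[OF on Suc.prems] by blast
    have ew: "lap w x = q w * w x" if "x \<in> X" for x
      by (rule maximizer_eigenvector[OF w max ev that])
    have "P (Suc k) (u(Suc k := w))"
      unfolding P_def
    proof (intro conjI allI impI ballI)
      show "orthonormal_on X (Suc (Suc k)) (u(Suc k := w))"
        unfolding orthonormal_on_def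
      proof (intro allI impI)
        fix i j assume "i < Suc (Suc k)" "j < Suc (Suc k)"
        then consider "i < Suc k" "j < Suc k" | "i < Suc k" "j = Suc k" | "i = Suc k" "j < Suc k"
          | "i = Suc k" "j = Suc k" by linarith
        then show "ip X ((u(Suc k := w)) i) ((u(Suc k := w)) j) = (if i = j then 1 else 0)"
          by cases (use w orthonormal_onD[OF on] in \<open>auto simp: ip_commute[of X w "u _"]\<close>)
      qed
    next
      fix i x assume "i \<le> Suc k" "x \<in> X"
      then show "lap ((u(Suc k := w)) i) x = q ((u(Suc k := w)) i) * (u(Suc k := w)) i x"
        using ew ev by (cases "i = Suc k") auto
    next
      fix i v assume i: "i \<le> Suc k" "0 < i" and v: "\<forall>j<i. ip X ((u(Suc k := w)) j) v = 0"
      then have v': "\<And>j. j < i \<Longrightarrow> ip X (u j) v = 0" by (metis fun_upd_other less_le_trans nat_neq_iff)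
      show "q v \<le> q ((u(Suc k := w)) i) * ip X v v"
      proof (cases "i = Suc k")
        case True
        then show ?thesis using max v' by simp
      next
        case False
        then show ?thesis using u i v' by (simp add: P_def)
      qed
    next
      show "(u(Suc k := w)) 0 = (\<lambda>x. 1 / sqrt ?n)" using u by (simp add: P_def)
    qed
    then show ?case by blast
  qed
  obtain u where u: "P (?n - 1) u" using chain[of "?n - 1"] n by auto
  have on: "orthonormal_on X ?n u" using u n by (simp add: P_def)
  have ev: "lap (u i) x = q (u i) * u i x" if "i < ?n" "x \<in> X" for i x
    using u that by (auto simp: P_def)
  have mono: "q (u i) \<le> q (u j)" if "0 < j" "j \<le> i" "i < ?n" for i j
  proof -
    have "\<forall>l<j. ip X (u l) (u i) = 0" using on that by (simp add: orthonormal_onD)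
    then have "q (u i) \<le> q (u j) * ip X (u i) (u i)" using u that by (simp add: P_def)
    then show ?thesis using on that by (simp add: orthonormal_onD)
  qed
  \<comment> \<open>The cyclic shift that puts the constant vector last and the maximizers in
    front.\<close>
  define \<sigma> where "\<sigma> = (\<lambda>i. if i = ?n - 1 then 0 else Suc i)"
  have \<sigma>: "\<sigma> i < ?n" if "i < ?n" for i using that by (auto simp: \<sigma>_def)
  have \<sigma>_inj: "\<sigma> i = \<sigma> j \<longleftrightarrow> i = j" if "i < ?n" "j < ?n" for i j using that by (auto simp: \<sigma>_def)
  have q0: "q (u 0) = 0" using u by (simp add: P_def dirichlet_def)
  have "eigenbasis (\<lambda>i. u (\<sigma> i)) (\<lambda>i. q (u (\<sigma> i)))"
    unfolding eigenbasis_def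
  proof (intro conjI allI impI ballI)
    show "orthonormal_on X ?n (\<lambda>i. u (\<sigma> i))"
      using on \<sigma> \<sigma>_inj by (simp add: orthonormal_on_def)
    show "lap (u (\<sigma> i)) x = q (u (\<sigma> i)) * u (\<sigma> i) x" if "i < ?n" "x \<in> X" for i x
      using ev \<sigma> that by simp
    show "q (u (\<sigma> i)) \<le> q (u (\<sigma> j))" if "i < ?n" "j \<le> i" for i j
      using that q0 q_nonneg mono[of "\<sigma> j" "\<sigma> i"] by (auto simp: \<sigma>_def)
    show "u (\<sigma> (?n - 1)) x = 1 / sqrt ?n" for x using u by (simp add: \<sigma>_def P_def)
  qed
  then show ?thesis by blast
qed

end

section \<open>Inequalities for sums of Rayleigh quotients\<close>

lemma sum_of_bool_mult:
  "finite A \<Longrightarrow> (\<Sum>y\<in>A. of_bool (P y) * f y) = (\<Sum>y\<in>{y \<in> A. P y}. f y :: real)"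
  by (simp add: Int_def)

lemma sum_lessThan_add: "(\<Sum>i<k + h :: nat. f i) = (\<Sum>i<k. f i) + (\<Sum>i<h. f (k + i) :: real)"
  by (induction h) auto

context finite_sym_graph
begin

lemma eigenbasisD:
  assumes "eigenbasis u \<mu>"
  shows "orthonormal_on X (card X) u"
    "i < card X \<Longrightarrow> x \<in> X \<Longrightarrow> lap (u i) x = \<mu> i * u i x"
    "i < card X \<Longrightarrow> j \<le> i \<Longrightarrow> \<mu> i \<le> \<mu> j"
    "x \<in> X \<Longrightarrow> u (card X - 1) x = 1 / sqrt (card X)"
    "i < card X \<Longrightarrow> \<mu> i = q (u i)"
proof -
  show on: "orthonormal_on X (card X) u"
    and ev: "i < card X \<Longrightarrow> x \<in> X \<Longrightarrow> lap (u i) x = \<mu> i * u i x"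
    and "i < card X \<Longrightarrow> j \<le> i \<Longrightarrow> \<mu> i \<le> \<mu> j"
    and "x \<in> X \<Longrightarrow> u (card X - 1) x = 1 / sqrt (card X)" for i j x
    using assms by (auto simp: eigenbasis_def)
  show "i < card X \<Longrightarrow> \<mu> i = q (u i)" by (rule eigenvalue_eq_q[OF on]) (auto intro: ev)
qed

lemma eigenbasis_sum_zero:
  assumes u: "eigenbasis u \<mu>" and i: "i < card X - 1"
  shows "(\<Sum>x\<in>X. u i x) = 0"
proof -
  have "ip X (u i) (u (card X - 1)) = 0"
    using i orthonormal_onD[OF eigenbasisD(1)[OF u], of i "card X - 1"] by simp
  moreover have "ip X (u i) (u (card X - 1)) = (\<Sum>x\<in>X. u i x) / sqrt (card X)"
    unfolding ip_def using eigenbasisD(4)[OF u] by (simp add: sum_divide_distrib)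
  ultimately show ?thesis using i by auto
qed

lemma dirichlet_expansion:
  assumes u: "eigenbasis u \<mu>"
  shows "q v = (\<Sum>l<card X. \<mu> l * (ip X (u l) v)\<^sup>2)"
proof -
  note on = eigenbasisD(1)[OF u]
  have c: "ip X (u l) (lap v) = \<mu> l * ip X (u l) v" if "l < card X" for l
    unfolding ip_lap_commute[symmetric] ip_scale_left[symmetric]
    by (rule ip_cong) (auto simp: eigenbasisD(2)[OF u that])
  have "q v = ip X (\<lambda>x. \<Sum>l<card X. ip X (u l) (lap v) * u l x) v"
    unfolding q_eq by (intro ip_cong) (simp_all add: orthonormal_complete[OF finite_X on])
  also have "\<dots> = (\<Sum>l<card X. ip X (u l) (lap v) * ip X (u l) v)" by (rule ip_sum_left)
  also have "\<dots> = (\<Sum>l<card X. \<mu> l * (ip X (u l) v)\<^sup>2)"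
    by (intro sum.cong) (auto simp: c power2_eq_square)
  finally show ?thesis .
qed

text \<open>The sum on the left is a weighted sum of eigenvalues, with weights \<open>c l\<close> in
  [0, 1] of total k. Such a sum is largest when the weights sit on the first k eigenvalues.\<close>

lemma ky_fan:
  assumes u: "eigenbasis u \<mu>" and v: "orthonormal_on X k v" and k: "k \<le> card X"
  shows "(\<Sum>i<k. q (v i)) \<le> (\<Sum>i<k. \<mu> i)"
proof (cases "k = 0")
  case False
  let ?n = "card X"
  note on = eigenbasisD(1)[OF u]
  define c where "c = (\<lambda>l. \<Sum>i<k. (ip X (v i) (u l))\<^sup>2)"
  have c0: "0 \<le> c l" for l by (simp add: c_def sum_nonneg)
  have c1: "c l \<le> 1" if "l < ?n" for l
    using bessel[OF v, of "u l"] orthonormal_onD[OF on that that] by (simp add: c_def)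
  have "(\<Sum>l<?n. c l) = (\<Sum>i<k. \<Sum>l<?n. (ip X (u l) (v i))\<^sup>2)"
    unfolding c_def by (subst sum.swap) (simp add: ip_commute)
  also have "\<dots> = k" using v by (simp add: parseval[OF finite_X on] orthonormal_onD)
  finally have csum: "(\<Sum>l<?n. c l) = k" .
  \<comment> \<open>The k-th largest eigenvalue as pivot: differences from it are nonnegative before
    index k and nonpositive from there on.\<close>
  define m where "m = \<mu> (k - 1)"
  have split: "(\<Sum>l<?n. f l) = (\<Sum>l<k. f l) + (\<Sum>l\<in>{k..<?n}. f l)" for f :: "nat \<Rightarrow> real"
    using k by (metis lessThan_atLeast0 le0 sum.atLeastLessThan_concat)
  have "(\<Sum>i<k. q (v i)) = (\<Sum>l<?n. \<mu> l * c l)"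
    unfolding dirichlet_expansion[OF u] c_def sum_distrib_left
    by (subst sum.swap) (simp add: ip_commute)
  also have "\<dots> = (\<Sum>l<?n. (\<mu> l - m) * c l) + m * k"
    by (simp add: left_diff_distrib sum_subtractf csum flip: sum_distrib_left)
  also have "(\<Sum>l<?n. (\<mu> l - m) * c l) \<le> (\<Sum>l<k. \<mu> l - m)"
  proof -
    have "(\<Sum>l<k. (\<mu> l - m) * c l) \<le> (\<Sum>l<k. \<mu> l - m)"
    proof (intro sum_mono mult_right_le_one_le)
      fix l assume l: "l \<in> {..<k}"
      then show "0 \<le> \<mu> l - m" unfolding m_def using eigenbasisD(3)[OF u, of "k - 1" l] k by auto
      show "c l \<le> 1" using l k by (intro c1) auto
    qed (rule c0)
    moreover have "(\<Sum>l\<in>{k..<?n}. (\<mu> l - m) * c l) \<le> 0"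
      using eigenbasisD(3)[OF u, of _ "k - 1"]
      by (intro sum_nonpos mult_nonpos_nonneg c0) (auto simp: m_def)
    ultimately show ?thesis unfolding split by linarith
  qed
  finally show ?thesis by (simp add: sum_subtractf)
qed simp

text \<open>For every arc, Bessel's inequality is applied to the difference of the two point masses,
  of squared norm 2. As \<open>card E\<close> counts arcs, the bound is the trace of L.\<close>

lemma sum_dirichlet_le_card:
  assumes v: "orthonormal_on X k v" and irrefl: "irrefl E"
  shows "(\<Sum>i<k. q (v i)) \<le> card E"
proof -
  have "(\<Sum>i<k. (v i x - v i y)\<^sup>2) \<le> 2" if xy: "(x, y) \<in> E" for x y
  proof -
    define b where "b = (\<lambda>z. (if z = x then 1 else 0) - (if z = y then 1 else 0 :: real))"
    have X: "x \<in> X" "y \<in> X" "x \<noteq> y" using xy E_subset irrefl by (auto simp: irrefl_def)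
    have "ip X w b = w x - w y" for w
      unfolding b_def ip_diff_right using X by (simp add: ip_delta[OF finite_X])
    moreover from this have "ip X b b = 2" using X by (simp add: b_def)
    ultimately show ?thesis using bessel[OF v, of b] by simp
  qed
  then have "(\<Sum>(x, y)\<in>E. \<Sum>i<k. (v i x - v i y)\<^sup>2) \<le> (\<Sum>(x, y)\<in>E. 2)"
    by (intro sum_mono) auto
  moreover have "(\<Sum>i<k. q (v i)) = (\<Sum>(x, y)\<in>E. \<Sum>i<k. (v i x - v i y)\<^sup>2) / 2"
    unfolding dirichlet_def split_def sum_divide_distrib by (subst sum.swap) simp
  ultimately show ?thesis by simp
qed

lemma finite_neighbours: "finite (E `` {x})"
  using finite_subset[OF _ finite_X, of "E `` {x}"] E_subset by auto

lemma card_E: "real (card E) = (\<Sum>x\<in>X. real (card (E `` {x})))"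
  using sum_E_iterated[of "\<lambda>_ _. 1 :: real"] by simp

text \<open>The Laplacians of a loopless graph and its complement add up to nI - J, J being the
  all-one matrix; loops do not change the form.\<close>

lemma dirichlet_complement:
  "q v + dirichlet {(x, y) \<in> X \<times> X. x \<noteq> y \<and> (x, y) \<notin> E} v = card X * ip X v v - (\<Sum>x\<in>X. v x)\<^sup>2"
proof -
  let ?E' = "{(x, y) \<in> X \<times> X. x \<noteq> y \<and> (x, y) \<notin> E}" and ?f = "\<lambda>(x, y). (v x - v y)\<^sup>2"
  have "finite ?E'" by (rule finite_subset[of _ "X \<times> X"]) (use finite_X in auto)
  moreover have "E \<inter> ?E' = {}" by auto
  ultimately have "sum ?f E + sum ?f ?E' = sum ?f (E \<union> ?E')"
    using finite_E by (simp add: sum.union_disjoint)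
  also have "\<dots> = sum ?f (X \<times> X)"
    using finite_X E_subset by (intro sum.mono_neutral_left) auto
  also have "\<dots> = (\<Sum>x\<in>X. \<Sum>y\<in>X. (v x - v y)\<^sup>2)" by (simp add: sum.cartesian_product)
  also have "\<dots> = (\<Sum>x\<in>X. card X * (v x)\<^sup>2 - 2 * v x * (\<Sum>y\<in>X. v y) + (\<Sum>y\<in>X. (v y)\<^sup>2))"
    by (intro sum.cong) (auto simp: power2_diff sum.distrib sum_subtractf sum_distrib_left)
  also have "\<dots> = card X * (\<Sum>x\<in>X. (v x)\<^sup>2) - 2 * (\<Sum>x\<in>X. v x) * (\<Sum>x\<in>X. v x)
      + card X * (\<Sum>x\<in>X. (v x)\<^sup>2)"
    by (simp only: sum.distrib sum_subtractf sum_constant flip: sum_distrib_left sum_distrib_right)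
  also have "\<dots> = 2 * (card X * ip X v v - (\<Sum>x\<in>X. v x)\<^sup>2)"
    by (simp add: ip_def power2_eq_square)
  finally show ?thesis by (simp add: dirichlet_def add_divide_distrib[symmetric])
qed

lemma dirichlet_le: "q v \<le> card X * ip X v v"
proof -
  have "0 \<le> dirichlet {(x, y) \<in> X \<times> X. x \<noteq> y \<and> (x, y) \<notin> E} v"
    by (auto simp: dirichlet_def intro!: sum_nonneg)
  then show ?thesis using dirichlet_complement[of v] by (smt (verit) zero_le_power2)
qed

end

section \<open>The Grone--Merris bound\<close>

locale split_graph = finite_sym_graph +
  fixes K
  assumes K_subset: "K \<subseteq> X"
    and irrefl_E: "irrefl E"
    and clique: "x \<in> K \<Longrightarrow> y \<in> K \<Longrightarrow> x \<noteq> y \<Longrightarrow> (x, y) \<in> E"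
    and coclique: "x \<in> X - K \<Longrightarrow> y \<in> X - K \<Longrightarrow> (x, y) \<notin> E"
begin

lemma finite_K: "finite K"
  using K_subset finite_X by (rule finite_subset)

text \<open>The condition \<open>f x = 0\<close> allows the sum to run over the whole clique
  although x is not its own neighbour.\<close>

lemma sum_neighbours_K:
  assumes x: "x \<in> K" and f: "f x = 0"
  shows "(\<Sum>y\<in>E `` {x}. f y) = (\<Sum>y\<in>K. f y) + (\<Sum>y\<in>X - K. of_bool ((x, y) \<in> E) * (f y :: real))"
proof -
  have "E `` {x} = (K - {x}) \<union> {y \<in> X - K. (x, y) \<in> E}"
    using x clique E_subset irrefl_E by (auto simp: irrefl_def)
  then have "(\<Sum>y\<in>E `` {x}. f y) = (\<Sum>y\<in>K - {x}. f y) + (\<Sum>y\<in>{y \<in> X - K. (x, y) \<in> E}. f y)"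
    using finite_K finite_X by (simp add: sum.union_disjoint disjoint_iff)
  moreover have "(\<Sum>y\<in>K. f y) = (\<Sum>y\<in>K - {x}. f y)"
    using sum.remove[OF finite_K x, of f] f by simp
  moreover have "(\<Sum>y\<in>X - K. of_bool ((x, y) \<in> E) * f y) = (\<Sum>y\<in>{y \<in> X - K. (x, y) \<in> E}. f y)"
    using finite_X by (intro sum_of_bool_mult) auto
  ultimately show ?thesis by simp
qed

lemma sum_neighbours_coclique:
  assumes x: "x \<in> X - K"
  shows "(\<Sum>y\<in>E `` {x}. f y) = (\<Sum>y\<in>K. of_bool ((y, x) \<in> E) * (f y :: real))"
proof -
  have "E `` {x} = {y \<in> K. (y, x) \<in> E}"
    using x coclique E_subset sym_E by (auto simp: sym_def)
  then show ?thesis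
    by (simp only: sum_of_bool_mult[OF finite_K])
qed

text \<open>The number of edges between clique and coclique, since all neighbours of a coclique
  vertex lie in K.\<close>

definition cross :: real where
  "cross = (\<Sum>x\<in>X - K. real (card (E `` {x})))"

lemma cross_eq: "cross = (\<Sum>x\<in>K. \<Sum>y\<in>X - K. of_bool ((x, y) \<in> E))"
proof -
  have "cross = (\<Sum>y\<in>X - K. \<Sum>x\<in>K. of_bool ((x, y) \<in> E))"
    unfolding cross_def using sum_neighbours_coclique[of _ "\<lambda>_. 1"] by (intro sum.cong) auto
  then show ?thesis by (subst sum.swap)
qed

text \<open>Enumerations of K and of its complement turn the leading eigenvectors into an instance
  of \<open>split_eigenvectors\<close>. A nonempty coclique ensures that the constant vector is not
  among them.\<close>

lemma top_eigenvalues_le: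
  assumes u: "eigenbasis u \<mu>" and ne: "X - K \<noteq> {}"
  shows "(\<Sum>l<card K. \<mu> l) \<le> (real (card K))\<^sup>2 + cross"
proof -
  let ?N = "card K" and ?M = "card (X - K)"
  have M: "0 < ?M" using ne finite_X by (simp add: card_gt_0_iff)
  have n: "card X = ?N + ?M"
    using K_subset finite_X finite_K by (simp add: card_Diff_subset card_mono)
  obtain \<kappa> where "bij_betw \<kappa> {0..<?N} K" using ex_bij_betw_nat_finite[OF finite_K] by blast
  then have \<kappa>: "bij_betw \<kappa> {..<?N} K" by (simp add: lessThan_atLeast0)
  obtain \<nu> where "bij_betw \<nu> {0..<?M} (X - K)"
    using ex_bij_betw_nat_finite[of "X - K"] finite_X by blast
  then have \<nu>: "bij_betw \<nu> {..<?M} (X - K)" by (simp add: lessThan_atLeast0)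
  have \<kappa>K: "\<kappa> i \<in> K" if "i < ?N" for i using bij_betwE[OF \<kappa>] that by auto
  have \<nu>K: "\<nu> j \<in> X - K" if "j < ?M" for j using bij_betwE[OF \<nu>] that by auto
  have sum_\<kappa>: "(\<Sum>i<?N. f (\<kappa> i)) = sum f K" for f :: "'a \<Rightarrow> real"
    by (rule sum.reindex_bij_betw[OF \<kappa>])
  have sum_\<nu>: "(\<Sum>j<?M. f (\<nu> j)) = sum f (X - K)" for f :: "'a \<Rightarrow> real"
    by (rule sum.reindex_bij_betw[OF \<nu>])
  have sum_X: "sum f K + sum f (X - K) = sum f X" for f :: "'a \<Rightarrow> real"
    using sum.subset_diff[OF K_subset finite_X, of f] by simp
  define a where "a = (\<lambda>i j. of_bool ((\<kappa> i, \<nu> j) \<in> E) :: real)"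
  interpret split_weights ?N ?M a by unfold_locales (auto simp: a_def M)
  have d_eq: "d i = (\<Sum>y\<in>X - K. of_bool ((\<kappa> i, y) \<in> E))" for i
    unfolding d_def unfolding a_def by (rule sum_\<nu>)
  have e_eq: "e j = (\<Sum>x\<in>K. of_bool ((x, \<nu> j) \<in> E))" for j
    unfolding e_def unfolding a_def by (rule sum_\<kappa>)
  interpret split_eigenvectors ?N ?M a "\<lambda>l i. u l (\<kappa> i)" "\<lambda>l j. u l (\<nu> j)" \<mu>
  proof
    fix l i assume l: "l < ?N" and i: "i < ?N"
    have "\<mu> l * u l (\<kappa> i) = lap (u l) (\<kappa> i)"
      using l i n \<kappa>K K_subset by (intro eigenbasisD(2)[OF u, symmetric]) auto
    also have "\<dots> = (\<Sum>y\<in>K. u l (\<kappa> i) - u l y)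
        + (\<Sum>y\<in>X - K. of_bool ((\<kappa> i, y) \<in> E) * (u l (\<kappa> i) - u l y))"
      unfolding laplace_def by (rule sum_neighbours_K) (auto simp: \<kappa>K[OF i])
    also have "\<dots> = (?N + d i) * u l (\<kappa> i) - (\<Sum>k<?N. u l (\<kappa> k)) - (\<Sum>j<?M. a i j * u l (\<nu> j))"
      unfolding d_eq unfolding a_def sum_\<kappa>[of "u l"] sum_\<nu>[of "\<lambda>y. of_bool ((\<kappa> i, y) \<in> E) * u l y"]
      by (simp add: sum_subtractf right_diff_distrib distrib_right sum_distrib_right)
    finally show "\<mu> l * u l (\<kappa> i) = \<dots>" .
  next
    fix l j assume l: "l < ?N" and j: "j < ?M"
    have "\<mu> l * u l (\<nu> j) = lap (u l) (\<nu> j)"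
      using l j n \<nu>K by (intro eigenbasisD(2)[OF u, symmetric]) auto
    also have "\<dots> = (\<Sum>y\<in>K. of_bool ((y, \<nu> j) \<in> E) * (u l (\<nu> j) - u l y))"
      unfolding laplace_def by (rule sum_neighbours_coclique[OF \<nu>K[OF j]])
    also have "\<dots> = e j * u l (\<nu> j) - (\<Sum>i<?N. a i j * u l (\<kappa> i))"
      unfolding e_eq unfolding a_def sum_\<kappa>[of "\<lambda>x. of_bool ((x, \<nu> j) \<in> E) * u l x"]
      by (simp add: sum_subtractf right_diff_distrib sum_distrib_right)
    finally show "\<mu> l * u l (\<nu> j) = \<dots>" .
  next
    fix l assume "l < ?N"
    then have "l < card X - 1" using n M by linarith
    then show "(\<Sum>i<?N. u l (\<kappa> i)) + (\<Sum>j<?M. u l (\<nu> j)) = 0"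
      unfolding sum_\<kappa> sum_\<nu> sum_X by (rule eigenbasis_sum_zero[OF u])
  next
    fix l l' assume "l < ?N" "l' < ?N"
    then show "(\<Sum>i<?N. u l (\<kappa> i) * u l' (\<kappa> i)) + (\<Sum>j<?M. u l (\<nu> j) * u l' (\<nu> j))
        = (if l = l' then 1 else 0)"
      unfolding sum_\<kappa>[of "\<lambda>x. u l x * u l' x"] sum_\<nu>[of "\<lambda>x. u l x * u l' x"] sum_X ip_def[of X, symmetric]
      using n by (intro orthonormal_onD[OF eigenbasisD(1)[OF u]]) auto
  next
    fix l assume "l < ?N"
    then show "0 \<le> \<mu> l" using eigenbasisD(5)[OF u, of l] n q_nonneg by simp
  qed
  have "(\<Sum>i<?N. d i) = cross"
    unfolding d_eq cross_eq by (rule sum_\<kappa>)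
  then show ?thesis using sum_eigenvalues_le by simp
qed

text \<open>Some nonzero combination v of the first N + 1 eigenvectors vanishes on K. Its Rayleigh
  quotient is at least \<mu> i, and at most N because L acts on v at a coclique vertex as
  multiplication by the degree.\<close>

lemma low_eigenvalue_le:
  assumes u: "eigenbasis u \<mu>" and i: "card K \<le> i" "i < card X"
  shows "\<mu> i \<le> card K"
proof -
  let ?N = "card K"
  have N: "?N < card X" using i by linarith
  note on = eigenbasisD(1)[OF u]
  obtain \<kappa> where "bij_betw \<kappa> {0..<?N} K" using ex_bij_betw_nat_finite[OF finite_K] by blast
  then have \<kappa>: "K = \<kappa> ` {..<?N}" by (simp add: lessThan_atLeast0 bij_betw_def)
  \<comment> \<open>Padding with a zero column makes the matrix square and singular; a left kernel
    vector yields the combination.\<close>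
  define A where "A = (\<lambda>l i. if i < ?N then u l (\<kappa> i) else 0)"
  have "det (fmat (Suc ?N) A) = 0"
  proof (rule ccontr)
    assume "det (fmat (Suc ?N) A) \<noteq> 0"
    from row_system_solvable[OF this, of "\<lambda>_. 1"] obtain y
      where "\<forall>i<Suc ?N. (\<Sum>l<Suc ?N. y l * A l i) = 1" by blast
    then have "(\<Sum>l<Suc ?N. y l * A l ?N) = 1" by blast
    then show False by (simp add: A_def)
  qed
  then obtain c l0 where c: "\<forall>i<Suc ?N. (\<Sum>l<Suc ?N. c l * A l i) = 0" and l0: "l0 < Suc ?N" "c l0 \<noteq> 0"
    using det_fmat_nonzero_iff[of "Suc ?N" A] by blast
  define v where "v = (\<lambda>x. \<Sum>l<Suc ?N. c l * u l x)"
  have vK: "v x = 0" if "x \<in> K" for x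
  proof -
    have "x \<in> \<kappa> ` {..<?N}" using that by (subst \<kappa>[symmetric])
    then obtain i where i: "i < ?N" "x = \<kappa> i" by auto
    then show ?thesis using c[rule_format, of i] by (simp add: v_def A_def)
  qed
  have coef: "ip X (u l) v = (if l < Suc ?N then c l else 0)" if "l < card X" for l
  proof -
    have "ip X (u l) v = (\<Sum>l'<Suc ?N. c l' * (if l = l' then 1 else 0))"
      unfolding v_def ip_sum_right using N that by (intro sum.cong) (auto simp: orthonormal_onD[OF on])
    then show ?thesis by (simp add: if_distrib[of "(*) _"] cong: if_cong)
  qed
  have pos: "0 < ip X v v"
  proof -
    have "0 < (c l0)\<^sup>2" using l0 by simp
    also have "\<dots> = (ip X (u l0) v)\<^sup>2" using coef[of l0] l0 N by simp
    also have "\<dots> \<le> (\<Sum>l<card X. (ip X (u l) v)\<^sup>2)" using l0 N by (intro member_le_sum) auto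
    also have "\<dots> = ip X v v" by (rule parseval[OF finite_X on])
    finally show ?thesis .
  qed
  have "\<mu> i * ip X v v \<le> q v"
    unfolding parseval[OF finite_X on, symmetric] dirichlet_expansion[OF u] sum_distrib_left
  proof (rule sum_mono)
    fix l assume l: "l \<in> {..<card X}"
    show "\<mu> i * (ip X (u l) v)\<^sup>2 \<le> \<mu> l * (ip X (u l) v)\<^sup>2"
      using eigenbasisD(3)[OF u i(2), of l] i coef[of l] l
      by (cases "l < Suc ?N") (auto intro!: mult_right_mono)
  qed
  also have "q v \<le> ?N * ip X v v"
    unfolding q_eq ip_def sum_distrib_left
  proof (rule sum_mono)
    fix x assume x: "x \<in> X"
    show "lap v x * v x \<le> ?N * (v x * v x)"
    proof (cases "x \<in> K")
      case True
      then show ?thesis using vK by simp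
    next
      case False
      then have "lap v x = (\<Sum>y\<in>K. of_bool ((y, x) \<in> E) * v x)"
        unfolding laplace_def using x vK by (simp add: sum_neighbours_coclique)
      also have "\<dots> = (\<Sum>y\<in>K. of_bool ((y, x) \<in> E)) * v x" by (simp add: sum_distrib_right)
      finally have eq: "lap v x * v x = (\<Sum>y\<in>K. of_bool ((y, x) \<in> E)) * (v x * v x)" by simp
      have "(\<Sum>y\<in>K. of_bool ((y, x) \<in> E) :: real) \<le> (\<Sum>y\<in>K. 1)" by (intro sum_mono) auto
      then show ?thesis unfolding eq by (intro mult_right_mono) auto
    qed
  qed
  finally show ?thesis using pos by simp
qed

lemma split_bound_many:
  assumes v: "orthonormal_on X k v" and k: "card K \<le> k" "k \<le> card X" and ne: "X - K \<noteq> {}"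
  shows "(\<Sum>i<k. q (v i)) \<le> real k * card K + cross"
proof -
  have "X \<noteq> {}" using ne by auto
  then obtain u \<mu> where u: "eigenbasis u \<mu>" using eigenbasis_exists by blast
  have "(\<Sum>i<k. q (v i)) \<le> (\<Sum>i<k. \<mu> i)" by (rule ky_fan[OF u v k(2)])
  also have "\<dots> = (\<Sum>i<card K. \<mu> i) + (\<Sum>i\<in>{card K..<k}. \<mu> i)"
    using k(1) by (metis lessThan_atLeast0 le0 sum.atLeastLessThan_concat)
  also have "(\<Sum>i\<in>{card K..<k}. \<mu> i) \<le> (\<Sum>i\<in>{card K..<k}. real (card K))"
    using k by (intro sum_mono low_eigenvalue_le[OF u]) auto
  also have "\<dots> = (real k - card K) * card K" using k by (simp add: of_nat_diff)
  finally show ?thesis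
    using top_eigenvalues_le[OF u ne] by (simp add: algebra_simps power2_eq_square)
qed

lemma complement: "split_graph X {(x, y) \<in> X \<times> X. x \<noteq> y \<and> (x, y) \<notin> E} (X - K)"
proof unfold_locales
  show "sym {(x, y) \<in> X \<times> X. x \<noteq> y \<and> (x, y) \<notin> E}" using sym_E by (auto simp: sym_def)
  fix x y assume "x \<in> X - (X - K)" "y \<in> X - (X - K)"
  then show "(x, y) \<notin> {(x, y) \<in> X \<times> X. x \<noteq> y \<and> (x, y) \<notin> E}" using clique[of x y] by auto
qed (use finite_X coclique in \<open>auto simp: irrefl_def\<close>)

text \<open>An upper bound for the complement bounds the eigenvalues after the first k from below;
  the trace bound then limits the first k from above.\<close>

lemma split_bound_few:
  assumes v: "orthonormal_on X k v" and k: "k < card K"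
  shows "(\<Sum>i<k. q (v i)) \<le> real k * card K + cross"
proof -
  let ?E' = "{(x, y) \<in> X \<times> X. x \<noteq> y \<and> (x, y) \<notin> E}"
  let ?n = "card X" and ?N = "card K" and ?M = "card (X - K)"
  interpret c: split_graph X ?E' "X - K" by (rule complement)
  have n: "?n = ?N + ?M"
    using K_subset finite_X finite_K by (simp add: card_Diff_subset card_mono)
  have KX: "X - (X - K) = K" using K_subset by auto
  have "K \<noteq> {}" using k by auto
  then have "X \<noteq> {}" using K_subset by auto
  then obtain u \<mu> where u: "eigenbasis u \<mu>" using eigenbasis_exists by blast
  note on = eigenbasisD(1)[OF u]
  \<comment> \<open>The vectors from index k to n - 2: the constant vector at n - 1 is left out, as
    passing to the complement replaces \<mu> by n - \<mu> only on its orthogonal complement. Since k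
    < N, there are at least M of them.\<close>
  define h where "h = ?n - 1 - k"
  have h: "k + h = ?n - 1" "Suc (?n - 1) = ?n" "?M \<le> h" "h \<le> ?n" using k n by (auto simp: h_def)
  have "(\<Sum>i<h. dirichlet ?E' (u (k + i))) \<le> real h * ?M + c.cross"
    using on h \<open>K \<noteq> {}\<close> KX
    by (intro c.split_bound_many) (auto simp: orthonormal_on_def)
  moreover have "dirichlet ?E' (u (k + i)) = ?n - \<mu> (k + i)" if "i < h" for i
  proof -
    have "k + i < ?n - 1" using that h by linarith
    then show ?thesis
      using dirichlet_complement[of "u (k + i)"] eigenbasis_sum_zero[OF u, of "k + i"]
        eigenbasisD(5)[OF u, of "k + i"] orthonormal_onD[OF on, of "k + i" "k + i"] by simp
  qed
  ultimately have "(\<Sum>i<h. ?n - \<mu> (k + i)) \<le> real h * ?M + c.cross" by simp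
  then have low: "real h * ?n - (\<Sum>i<h. \<mu> (k + i)) \<le> real h * ?M + c.cross"
    by (simp add: sum_subtractf)
  have "(\<Sum>i<?n. \<mu> i) = (\<Sum>i<?n. q (u i))" using eigenbasisD(5)[OF u] by simp
  also have "\<dots> \<le> card E" by (rule sum_dirichlet_le_card[OF on irrefl_E])
  finally have "(\<Sum>i<?n. \<mu> i) \<le> card E" .
  moreover have "(\<Sum>i<?n. \<mu> i) = (\<Sum>i<k. \<mu> i) + (\<Sum>i<h. \<mu> (k + i)) + \<mu> (?n - 1)"
    using sum.lessThan_Suc[of \<mu> "?n - 1"] sum_lessThan_add[of \<mu> k h] unfolding h(1,2) by simp
  moreover have "0 \<le> \<mu> (?n - 1)" using eigenbasisD(5)[OF u, of "?n - 1"] h q_nonneg by simp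
  ultimately have top: "(\<Sum>i<k. \<mu> i) \<le> card E - (\<Sum>i<h. \<mu> (k + i))" by linarith
  \<comment> \<open>Arcs inside the clique, and each cross edge in both directions.\<close>
  have edges: "card E = real ?N * (real ?N - 1) + 2 * cross"
  proof -
    have "real (card (E `` {x})) = (real ?N - 1) + (\<Sum>y\<in>X - K. of_bool ((x, y) \<in> E))" if "x \<in> K" for x
    proof -
      have "real (card (E `` {x})) = (\<Sum>y\<in>E `` {x}. of_bool (y \<noteq> x))"
      proof -
        have "(\<Sum>y\<in>E `` {x}. of_bool (y \<noteq> x)) = (\<Sum>y\<in>E `` {x}. 1 :: real)"
          using irrefl_E by (intro sum.cong) (auto simp: irrefl_def)
        then show ?thesis by simp
      qed
      also have "\<dots> = (\<Sum>y\<in>K. of_bool (y \<noteq> x)) + (\<Sum>y\<in>X - K. of_bool ((x, y) \<in> E) * of_bool (y \<noteq> x))"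
        by (rule sum_neighbours_K[OF that]) simp
      also have "(\<Sum>y\<in>K. of_bool (y \<noteq> x) :: real) = real ?N - 1"
      proof -
        have "(\<Sum>y\<in>K. of_bool (y \<noteq> x) :: real) = (\<Sum>y\<in>K. 1 - of_bool (y = x))"
          by (intro sum.cong) auto
        also have "\<dots> = real ?N - 1"
          using that finite_K by (simp add: sum_subtractf of_bool_def)
        finally show ?thesis .
      qed
      also have "(\<Sum>y\<in>X - K. of_bool ((x, y) \<in> E) * of_bool (y \<noteq> x) :: real)
          = (\<Sum>y\<in>X - K. of_bool ((x, y) \<in> E))"
        using that by (intro sum.cong) auto
      finally show ?thesis .
    qed
    then have "(\<Sum>x\<in>K. real (card (E `` {x}))) = real ?N * (real ?N - 1) + cross"
      unfolding cross_eq by (simp add: sum.distrib)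
    then show ?thesis
      unfolding card_E sum.subset_diff[OF K_subset finite_X] by (simp add: cross_def)
  qed
  have "c.cross = (\<Sum>x\<in>X - K. \<Sum>y\<in>K. 1 - of_bool ((y, x) \<in> E))"
    unfolding c.cross_eq KX using K_subset sym_E by (intro sum.cong) (auto simp: sym_def)
  also have "\<dots> = real ?M * ?N - cross"
    unfolding cross_eq by (subst sum.swap) (simp add: sum_subtractf sum.swap[of _ K])
  finally have cross: "c.cross = real ?M * ?N - cross" .
  have "(\<Sum>i<k. q (v i)) \<le> (\<Sum>i<k. \<mu> i)" using k n by (intro ky_fan[OF u v]) auto
  also have "\<dots> \<le> card E - real h * ?n + real h * ?M + c.cross" using top low by linarith
  also have "\<dots> = real k * ?N + cross"
  proof -
    have hr: "real h = real ?N + real ?M - 1 - real k" using k n by (simp add: h_def of_nat_diff)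
    show ?thesis unfolding edges cross n hr by (simp add: algebra_simps)
  qed
  finally show ?thesis .
qed

end

text \<open>The empty W is separate because the split bounds with many vectors need a nonempty
  coclique; there every Rayleigh quotient is at most \<open>card X\<close>.\<close>

theorem (in finite_sym_graph) grone_merris_bound:
  assumes irrefl: "irrefl E" and W: "W \<subseteq> X"
    and v: "orthonormal_on X k v" and k: "k \<le> card X"
  shows "(\<Sum>i<k. q (v i)) \<le> real k * card (X - W) + (\<Sum>x\<in>W. real (card (E `` {x})))"
proof (cases "W = {}")
  case True
  have "q (v i) \<le> card X" if "i < k" for i
    using dirichlet_le[of "v i"] orthonormal_onD[OF v that that] by simp
  then have "(\<Sum>i<k. q (v i)) \<le> (\<Sum>i<k. real (card X))" by (intro sum_mono) auto
  then show ?thesis using True by simp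
next
  case False
  define K where "K = X - W"
  have XK: "X - K = W" using W by (auto simp: K_def)
  define E1 where "E1 = E \<inter> W \<times> W"
  define E2 where "E2 = (E - W \<times> W) \<union> {(x, y) \<in> K \<times> K. x \<noteq> y}"
  interpret g1: finite_sym_graph X E1
    using finite_X E_subset sym_E by unfold_locales (auto simp: E1_def sym_def)
  interpret g2: split_graph X E2 K
    using finite_X E_subset sym_E irrefl
    by unfold_locales (auto simp: E2_def K_def sym_def irrefl_def)
  have le: "q w \<le> dirichlet E1 w + dirichlet E2 w" for w
  proof -
    let ?f = "\<lambda>(x, y). (w x - w y)\<^sup>2"
    have "sum ?f E = sum ?f E1 + sum ?f (E - E1)"
      using sum.subset_diff[of E1 E ?f] finite_E by (simp add: E1_def)
    also have "sum ?f (E - E1) \<le> sum ?f E2"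
      using g2.finite_E by (intro sum_mono2) (auto simp: E1_def E2_def)
    finally show ?thesis by (simp add: dirichlet_def add_divide_distrib[symmetric])
  qed
  have "irrefl E1" using irrefl by (auto simp: E1_def irrefl_def)
  then have "(\<Sum>i<k. dirichlet E1 (v i)) \<le> card E1" by (rule g1.sum_dirichlet_le_card[OF v])
  also have "real (card E1) = (\<Sum>x\<in>W. real (card (E1 `` {x})))"
  proof -
    have "E1 `` {x} = {}" if "x \<notin> W" for x using that by (auto simp: E1_def)
    then show ?thesis
      unfolding g1.card_E using finite_X W by (intro sum.mono_neutral_right) auto
  qed
  finally have 1: "(\<Sum>i<k. dirichlet E1 (v i)) \<le> (\<Sum>x\<in>W. real (card (E1 `` {x})))" .
  have 2: "(\<Sum>i<k. dirichlet E2 (v i)) \<le> real k * card K + g2.cross"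
    using g2.split_bound_many[OF v _ k] g2.split_bound_few[OF v] XK False by (cases "k < card K") auto
  \<comment> \<open>The arcs added in \<open>E2\<close> lie inside K, so on W the two degrees add up
    to the original one.\<close>
  have deg: "real (card (E `` {x})) = real (card (E1 `` {x})) + real (card (E2 `` {x}))" if "x \<in> W" for x
  proof -
    have "E `` {x} = E1 `` {x} \<union> E2 `` {x}" "E1 `` {x} \<inter> E2 `` {x} = {}"
      using that by (auto simp: E1_def E2_def K_def)
    then show ?thesis using g1.finite_neighbours g2.finite_neighbours by (simp add: card_Un_disjoint)
  qed
  have "(\<Sum>i<k. q (v i)) \<le> (\<Sum>i<k. dirichlet E1 (v i)) + (\<Sum>i<k. dirichlet E2 (v i))"
    unfolding sum.distrib[symmetric] by (intro sum_mono le)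
  also have "\<dots> \<le> (\<Sum>x\<in>W. real (card (E1 `` {x}))) + (real k * card K + g2.cross)"
    using 1 2 by linarith
  also have "\<dots> = real k * card (X - W) + (\<Sum>x\<in>W. real (card (E `` {x})))"
    unfolding g2.cross_def XK by (simp add: deg sum.distrib K_def)
  finally show ?thesis .
qed

section \<open>Brouwer's inequality\<close>

lemma char_poly_orthonormal_eigenvectors:
  fixes A Q :: "real mat"
  assumes A: "A \<in> carrier_mat n n" and Q: "Q \<in> carrier_mat n n"
    and orth: "transpose_mat Q * Q = 1\<^sub>m n"
    and eigen: "A * Q = Q * mat_diag n \<mu>"
  shows "char_poly A = (\<Prod>i\<leftarrow>[0..<n]. [:- \<mu> i, 1:])"
proof -
  let ?D = "mat_diag n \<mu>"
  have Qt: "transpose_mat Q \<in> carrier_mat n n" and D: "?D \<in> carrier_mat n n" using Q by auto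
  have orth': "Q * transpose_mat Q = 1\<^sub>m n" by (rule mat_mult_left_right_inverse[OF Qt Q orth])
  have "A = A * (Q * transpose_mat Q)" using A orth' by simp
  also have "\<dots> = Q * ?D * transpose_mat Q" using A Q Qt by (simp add: eigen assoc_mult_mat[symmetric])
  finally have "similar_mat_wit A ?D Q (transpose_mat Q)"
    by (intro similar_mat_witI[OF orth' orth _ A D Q Qt])
  then have "char_poly A = char_poly ?D" by (intro char_poly_similar) (auto simp: similar_mat_def)
  also have "\<dots> = (\<Prod>a\<leftarrow>diag_mat ?D. [:- a, 1:])"
    by (rule char_poly_upper_triangular[OF D]) (auto simp: mat_diag_def upper_triangular_def)
  also have "diag_mat ?D = map \<mu> [0..<n]" by (auto simp: mat_diag_def diag_mat_def)
  finally show ?thesis by (simp add: o_def)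
qed

lemma proots_prod_linear: "proots (\<Prod>i\<leftarrow>is. [:- f i, 1:]) = mset (map f is)" for f :: "'i \<Rightarrow> real"
proof (induction "is")
  case (Cons i "is")
  have "(\<Prod>i\<leftarrow>is. [:- f i, 1:]) \<noteq> 0" by (auto simp: prod_list_zero_iff)
  then have "proots ([:- f i, 1:] * (\<Prod>i\<leftarrow>is. [:- f i, 1:])) = proots [:- f i, 1:] + proots (\<Prod>i\<leftarrow>is. [:- f i, 1:])"
    by (intro proots_mult) auto
  then show ?case using Cons by simp
qed simp

lemma rev_sorted_list_of_multiset_antimono:
  assumes "\<And>i j. j \<le> i \<Longrightarrow> i < n \<Longrightarrow> f i \<le> (f j :: real)"
  shows "rev (sorted_list_of_multiset (mset (map f [0..<n]))) = map f [0..<n]"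
proof -
  have "sorted (rev (map f [0..<n]))"
    using assms by (auto simp: sorted_iff_nth_mono rev_nth)
  then have "sort (rev (map f [0..<n])) = rev (map f [0..<n])" by (rule sorted_sort_id)
  moreover have "sorted_list_of_multiset (mset (map f [0..<n])) = sort (rev (map f [0..<n]))"
    by (metis mset_rev sorted_list_of_multiset_mset)
  ultimately show ?thesis by simp
qed

section \<open>Transfer to the Laplacian matrix\<close>

context graph
begin

lemma finite_sym_graph_arcs: "finite_sym_graph (verts G) (arcs_ends G)"
proof
  show "sym (arcs_ends G)" using sym_arcs by (simp add: symmetric_def)
  show "arcs_ends G \<subseteq> verts G \<times> verts G" by (auto dest: adj_in_verts)
qed simp

lemma irrefl_arcs_ends: "irrefl (arcs_ends G)"
  using adj_not_same by (auto simp: irrefl_def)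

lemma out_degree_eq: "out_degree G v = card (arcs_ends G `` {v})"
proof -
  have "arcs_ends G `` {v} = head G ` out_arcs G v"
    by (auto simp: arcs_ends_conv)
  moreover have "inj_on (head G) (out_arcs G v)"
    using no_multi_arcs by (auto simp: inj_on_def arc_to_ends_def)
  ultimately show ?thesis by (simp add: card_image out_degree_def)
qed

lemma vertex_list: "distinct (vertex_list G)" "set (vertex_list G) = verts G"
proof -
  obtain vs where "set vs = verts G \<and> distinct vs" using finite_distinct_list[OF finite_verts] by blast
  then show "distinct (vertex_list G)" "set (vertex_list G) = verts G"
    unfolding vertex_list_def by (smt (verit, best) someI)+
qed

text \<open>Enumerated by \<open>vertex_list\<close>, the eigenbasis becomes an orthogonal matrix
  \<open>Q\<close> diagonalizing the Laplacian matrix, so its ordered eigenvalues are the values of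
  \<theta>. The bound on k keeps the list access in range.\<close>

lemma laplacian_sum_eq:
  assumes u: "finite_sym_graph.eigenbasis (verts G) (arcs_ends G) u \<theta>" and k: "k \<le> card (verts G)"
  shows "laplacian_sum G k = (\<Sum>i<k. dirichlet (arcs_ends G) (u i))"
proof -
  let ?X = "verts G" and ?E = "arcs_ends G" and ?n = "card (verts G)" and ?vs = "vertex_list G"
  interpret E: finite_sym_graph ?X ?E by (rule finite_sym_graph_arcs)
  have len: "length ?vs = ?n" using vertex_list distinct_card by metis
  have bij: "bij_betw (\<lambda>i. ?vs ! i) {..<?n} ?X"
    by (rule bij_betw_nth) (simp_all add: vertex_list len)
  have nth: "?vs ! i \<in> ?X" if "i < ?n" for i using bij_betwE[OF bij] that by auto
  have sum_nth: "(\<Sum>i<?n. f (?vs ! i)) = sum f ?X" for f :: "'a \<Rightarrow> real"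
    by (rule sum.reindex_bij_betw[OF bij])
  have inj: "?vs ! i = ?vs ! j \<longleftrightarrow> i = j" if "i < ?n" "j < ?n" for i j
    using that vertex_list(1) len by (simp add: nth_eq_iff_index_eq)
  define Q where "Q = mat ?n ?n (\<lambda>(i, l). u l (?vs ! i))"
  have Q: "Q \<in> carrier_mat ?n ?n" by (simp add: Q_def)
  have L: "laplacian_matrix G \<in> carrier_mat ?n ?n"
    by (auto simp: laplacian_matrix_def degree_matrix_def adjacency_matrix_def Let_def
        intro!: minus_carrier_mat)
  have L_index: "laplacian_matrix G $$ (i, j) = (if i = j then real (card (?E `` {?vs ! i})) else 0)
      - of_bool ((?vs ! i, ?vs ! j) \<in> ?E)" if "i < ?n" "j < ?n" for i j
    using that by (simp add: laplacian_matrix_def degree_matrix_def adjacency_matrix_def Let_def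
        out_degree_eq of_bool_def)
  have "transpose_mat Q * Q = 1\<^sub>m ?n"
  proof (rule eq_matI)
    fix l l' assume "l < dim_row (1\<^sub>m ?n)" "l' < dim_col (1\<^sub>m ?n)"
    then have l: "l < ?n" "l' < ?n" by auto
    have "(transpose_mat Q * Q) $$ (l, l') = (\<Sum>i<?n. u l (?vs ! i) * u l' (?vs ! i))"
      using l by (simp add: Q_def scalar_prod_def lessThan_atLeast0)
    also have "\<dots> = ip ?X (u l) (u l')"
      unfolding ip_def by (rule sum_nth)
    finally show "(transpose_mat Q * Q) $$ (l, l') = 1\<^sub>m ?n $$ (l, l')"
      using l orthonormal_onD[OF E.eigenbasisD(1)[OF u]] by simp
  qed (simp_all add: Q_def)
  moreover have "laplacian_matrix G * Q = Q * mat_diag ?n \<theta>"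
  proof (rule eq_matI)
    fix i l assume "i < dim_row (Q * mat_diag ?n \<theta>)" "l < dim_col (Q * mat_diag ?n \<theta>)"
    then have l: "i < ?n" "l < ?n" by (auto simp: Q_def mat_diag_def)
    let ?x = "?vs ! i"
    have "(laplacian_matrix G * Q) $$ (i, l) = (\<Sum>j<?n. laplacian_matrix G $$ (i, j) * u l (?vs ! j))"
      using l L by (simp add: Q_def scalar_prod_def lessThan_atLeast0)
    \<comment> \<open>The diagonal condition is restated for vertices instead of indices, so that
      the sum can be reindexed over \<open>verts G\<close>.\<close>
    also have "\<dots> = (\<Sum>j<?n. (if ?vs ! j = ?x then real (card (?E `` {?x})) * u l ?x else 0)
        - of_bool ((?x, ?vs ! j) \<in> ?E) * u l (?vs ! j))"
      using l by (intro sum.cong) (auto simp: L_index inj left_diff_distrib)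
    also have "\<dots> = (\<Sum>y\<in>?X. (if y = ?x then real (card (?E `` {?x})) * u l ?x else 0)
        - of_bool ((?x, y) \<in> ?E) * u l y)"
      by (rule sum_nth)
    also have "\<dots> = real (card (?E `` {?x})) * u l ?x - (\<Sum>y\<in>{y \<in> ?X. (?x, y) \<in> ?E}. u l y)"
      using nth[OF l(1)] by (simp add: sum_subtractf Int_def)
    also have "{y \<in> ?X. (?x, y) \<in> ?E} = ?E `` {?x}" using E.E_subset by auto
    also have "real (card (?E `` {?x})) * u l ?x - (\<Sum>y\<in>?E `` {?x}. u l y) = laplace ?E (u l) ?x"
      by (simp add: laplace_def sum_subtractf)
    also have "\<dots> = \<theta> l * u l ?x" by (rule E.eigenbasisD(2)[OF u l(2) nth[OF l(1)]])
    also have "\<dots> = (Q * mat_diag ?n \<theta>) $$ (i, l)"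
      using l Q by (simp add: mat_diag_mult_right[OF Q]) (simp add: Q_def)
    finally show "(laplacian_matrix G * Q) $$ (i, l) = (Q * mat_diag ?n \<theta>) $$ (i, l)" .
  qed (use L in \<open>simp_all add: Q_def mat_diag_def\<close>)
  ultimately have "char_poly (laplacian_matrix G) = (\<Prod>i\<leftarrow>[0..<?n]. [:- \<theta> i, 1:])"
    by (rule char_poly_orthonormal_eigenvectors[OF L Q])
  then have "laplacian_eigenvalues G = map \<theta> [0..<?n]"
    unfolding laplacian_eigenvalues_def
    by (simp only: proots_prod_linear) (rule rev_sorted_list_of_multiset_antimono, rule E.eigenbasisD(3)[OF u])
  then have "laplacian_sum G k = (\<Sum>i<k. \<theta> i)" using k by (simp add: laplacian_sum_def)
  then show ?thesis using k E.eigenbasisD(5)[OF u] by simp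
qed

theorem laplacian_sum_le:
  assumes W: "W \<subseteq> verts G" and k: "k \<le> card (verts G)"
  shows "laplacian_sum G k \<le> real k * card (verts G - W) + (\<Sum>v\<in>W. real (out_degree G v))"
proof (cases "verts G = {}")
  case True
  then show ?thesis using W k by (simp add: laplacian_sum_def)
next
  case False
  interpret E: finite_sym_graph "verts G" "arcs_ends G" by (rule finite_sym_graph_arcs)
  obtain u \<theta> where u: "E.eigenbasis u \<theta>" using E.eigenbasis_exists[OF False] by blast
  have "orthonormal_on (verts G) k u"
    using E.eigenbasisD(1)[OF u] k by (auto simp: orthonormal_on_def)
  then show ?thesis
    using E.grone_merris_bound[OF irrefl_arcs_ends W _ k] laplacian_sum_eq[OF u k]
    by (simp add: out_degree_eq)
qed

lemma out_degree_less: "v \<in> verts G \<Longrightarrow> out_degree G v < card (verts G)"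
  unfolding out_degree_eq using irrefl_arcs_ends
  by (intro psubset_card_mono) (auto simp: irrefl_def dest: adj_in_verts)

end

section \<open>The four ranges of k\<close>

theorem theorem2p9:
  fixes G :: "('a, 'b) pre_digraph" and n m p q r s :: nat
  assumes "graph G"
    and "Digraph_Component.connected G"
    and "n = card (verts G)" and "n \<ge> 4"
    and "m = card (edge_set G)"
    and "p = card {v \<in> verts G. out_degree G v = r}" and "p \<ge> 1"
    and "q = card {v \<in> verts G. out_degree G v = s}" and "q \<ge> 1"
    and "q \<noteq> p"
    and "s > r" and "r \<ge> 1"
  shows
    "(real m \<ge> (2 * real n - real r - 1) * real r / 2 \<longrightarrow>
       (\<forall>k::nat. 1 \<le> k \<and> k \<le> r \<longrightarrow> brouwer_holds G k))
     \<and>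
     ((real n > real p + real s + 1 / 2 \<and>
       real m \<ge> real s * (2 * real n - 2 * real p - real s - 1) / 2 + real p * real r
       \<or>
       real n < real p + real r + 3 / 2 \<and>
       real m \<ge> (real r + 1) * (2 * real n - 2 * real p - real r - 2) / 2 + real p * real r)
       \<longrightarrow>
       (\<forall>k::nat. r + 1 \<le> k \<and> k \<le> s \<longrightarrow> brouwer_holds G k))
     \<and>
     (real p + real q < real n / 2 \<and>
      real m \<ge> (real n - 1) * (3 * real n - 1) / 8
                - (real n - 2 * real r - 1) / 2 * real p
                - (real n - 2 * real s - 1) / 2 * real q
       \<longrightarrow>
       (\<forall>k::nat. s + 1 \<le> k \<and> real k \<le> (real n - 1) / 2 \<longrightarrow> brouwer_holds G k))
     \<and>
     (real p + real q > real n / 2 \<and>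
      real m \<ge> (real n - 1) * (3 * real n - 1) / 8
                - (real n - 2 * real r - 1) / 2 * real p
                - (real n - 2 * real s - 1) / 2 * real q
       \<longrightarrow>
       (\<forall>k::nat. (real n - 1) / 2 \<le> real k \<and> k \<le> n \<longrightarrow> brouwer_holds G k))"
proof -
  interpret graph G by (rule assms(1))
  let ?P = "{v \<in> verts G. out_degree G v = r}" and ?Q = "{v \<in> verts G. out_degree G v = s}"
  have "card ?Q \<noteq> 0" using assms by linarith
  then have "?Q \<noteq> {}" by (metis card.empty)
  \<comment> \<open>A degree is below n, so the values of k in the first two ranges do not exceed
    the number of eigenvalues.\<close>
  then have sn: "s < n" using out_degree_less assms by auto
  have disj: "?P \<inter> ?Q = {}" using \<open>s > r\<close> by auto
  have pn: "p \<le> n" unfolding assms by (intro card_mono) auto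
  have pqn: "p + q \<le> n"
  proof -
    have "p + q = card (?P \<union> ?Q)" using disj assms by (simp add: card_Un_disjoint)
    also have "\<dots> \<le> n" unfolding assms by (intro card_mono) auto
    finally show ?thesis .
  qed
  have bound0: "laplacian_sum G k \<le> k * real n" if "k \<le> n" for k
    using laplacian_sum_le[of "{}" k] that assms by simp
  have boundP: "laplacian_sum G k \<le> k * (real n - p) + real p * r" if "k \<le> n" for k
  proof -
    have "real (card (verts G - ?P)) = real n - p"
      using assms pn by (simp add: card_Diff_subset of_nat_diff)
    then show ?thesis using laplacian_sum_le[of ?P k] that assms by simp
  qed
  have boundPQ: "laplacian_sum G k \<le> k * (real n - p - q) + real p * r + real q * s" if "k \<le> n" for k
  proof -
    have "card (verts G - (?P \<union> ?Q)) = n - (p + q)"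
      using assms disj by (simp add: card_Diff_subset card_Un_disjoint)
    moreover have "(\<Sum>v\<in>?P \<union> ?Q. real (out_degree G v)) = real p * r + real q * s"
      using assms disj by (simp add: sum.union_disjoint)
    ultimately show ?thesis using laplacian_sum_le[of "?P \<union> ?Q" k] that assms pqn
      by (simp add: of_nat_diff diff_diff_eq add.assoc)
  qed
  text \<open>All four conditions compare values of $f(x) = xN - x(x+1)/2$, which increases for
    $x \le N - \frac12$ and decreases afterwards.\<close>
  have f_diff: "(y * N - y * (y + 1) / 2) - (x * N - x * (x + 1) / 2) = (y - x) * (2 * N - x - y - 1) / 2"
    for x y N :: real by (simp add: field_simps)
  have f_le: "x * N - x * (x + 1) / 2 \<le> y * N - y * (y + 1) / 2"
    if "x \<le> y \<and> x + y + 1 \<le> 2 * N \<or> y \<le> x \<and> 2 * N \<le> x + y + 1" for x y N :: real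
  proof -
    have "0 \<le> (y - x) * (2 * N - x - y - 1)" using that by (auto simp: zero_le_mult_iff)
    then show ?thesis using f_diff[of y N x] by linarith
  qed
  \<comment> \<open>Here \<open>N\<close> is the number of vertices outside W, \<open>c\<close> the
    degree sum over W, and \<open>y\<close> the end of the range at which f is largest. It is real
    because (n - 1)/2 may be a half-integer.\<close>
  have brouwerI: "brouwer_holds G k"
    if "laplacian_sum G k \<le> k * N + c" "real k \<le> y \<and> k + y + 1 \<le> 2 * N \<or> y \<le> k \<and> 2 * N \<le> k + y + 1"
      "y * N - y * (y + 1) / 2 + c \<le> m" for k N c y
    using f_le[OF that(2)] that(1,3) assms unfolding brouwer_holds_def by simp
  show ?thesis
  proof (intro conjI impI allI; elim conjE)
    fix k assume "(2 * real n - r - 1) * r / 2 \<le> m" "1 \<le> k" "k \<le> r"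
    then show "brouwer_holds G k"
      using bound0[of k] sn \<open>s > r\<close> by (intro brouwerI[of k n 0 r]) (auto simp: field_simps)
  next
    fix k assume cond: "real n > real p + real s + 1 / 2 \<and>
       real m \<ge> real s * (2 * real n - 2 * real p - real s - 1) / 2 + real p * real r
       \<or>
       real n < real p + real r + 3 / 2 \<and>
       real m \<ge> (real r + 1) * (2 * real n - 2 * real p - real r - 2) / 2 + real p * real r"
      and k: "r + 1 \<le> k" "k \<le> s"
    have kn: "k \<le> n" using k sn by simp
    from cond show "brouwer_holds G k"
    proof
      \<comment> \<open>With N = n - p this says s < N - 1/2: f increases up to s, and s is the
        worst case.\<close>
      assume "real n > real p + real s + 1 / 2 \<and>
        real m \<ge> real s * (2 * real n - 2 * real p - real s - 1) / 2 + real p * real r"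
      then show ?thesis using boundP[OF kn] k
        by (intro brouwerI[of k "real n - p" "real p * r" s]) (auto simp: field_simps)
    next
      \<comment> \<open>Now r + 1 > N - 1/2: f decreases from r + 1 on, and r + 1 is the worst
        case.\<close>
      assume "real n < real p + real r + 3 / 2 \<and>
        real m \<ge> (real r + 1) * (2 * real n - 2 * real p - real r - 2) / 2 + real p * real r"
      then show ?thesis using boundP[OF kn] k
        by (intro brouwerI[of k "real n - p" "real p * r" "r + 1"]) (auto simp: field_simps)
    qed
  next
    fix k assume "real p + real q < real n / 2"
      and "(real n - 1) * (3 * real n - 1) / 8 - (real n - 2 * real r - 1) / 2 * real p
        - (real n - 2 * real s - 1) / 2 * real q \<le> real m"
      and k: "s + 1 \<le> k" "real k \<le> (real n - 1) / 2"
    moreover have "real k \<le> real n" using k(2) by (simp add: field_simps)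
    \<comment> \<open>Here N = n - p - q > n/2, so k + y + 1 \<le> n < 2N for y = (n - 1)/2.\<close>
    ultimately show "brouwer_holds G k" using boundPQ[of k]
      by (intro brouwerI[of k "real n - p - q" "real p * r + real q * s" "(real n - 1) / 2"])
        (auto simp: field_simps)
  next
    fix k assume "real p + real q > real n / 2"
      and "(real n - 1) * (3 * real n - 1) / 8 - (real n - 2 * real r - 1) / 2 * real p
        - (real n - 2 * real s - 1) / 2 * real q \<le> real m"
      and k: "(real n - 1) / 2 \<le> real k" "k \<le> n"
    \<comment> \<open>The mirror image: N < n/2 gives 2N < n \<le> k + y + 1, and f is largest at
      the left end.\<close>
    then show "brouwer_holds G k" using boundPQ[of k]
      by (intro brouwerI[of k "real n - p - q" "real p * r + real q * s" "(real n - 1) / 2"])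
        (auto simp: field_simps)
  qed
qed

end
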